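(* The space $L_1(0,\infty)$ admits a Schauder basis consisting of non-negative functions. Consequently, every separable $L_1$ space (that is, every separable space of the form $L_1(\mu)$ for a measure $\mu$) admits a Schauder basis consisting of non-negative functions.
   Context: $L_1(0,\infty)$ is taken with respect to Lebesgue measure on $(0,\infty)$. Non-negative means non-negative almost everywhere. A Schauder basis of a Banach space $X$ is a sequence $\{x_n\}$ in $X$ such that every $x\in X$ has a unique representation $x=\sum_n a_n x_n$ with scalars $a_n$, the series converging in norm; for a finite-dimensional space this means an ordinary (finite) basis. *)

theory Defs
  imports "HOL-Analysis.Analysis"
begin

(* Elements of the real Banach space L_1(M) are handled through representatives:
   integrable functions, with equality in L_1(M) being equality almost everywhere,
   i.e. L1_norm of the difference equal to 0. All notions below respect this equality. *)

definition L1 :: "'a measure \<Rightarrow> ('a \<Rightarrow> real) set" where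
  "L1 M = {f. integrable M f}"

definition L1_norm :: "'a measure \<Rightarrow> ('a \<Rightarrow> real) \<Rightarrow> real" where
  "L1_norm M f = (\<integral>x. \<bar>f x\<bar> \<partial>M)"

definition L1_separable :: "'a measure \<Rightarrow> bool" where
  "L1_separable M \<longleftrightarrow>
    (\<exists>D. countable D \<and> D \<subseteq> L1 M \<and>
      (\<forall>f\<in>L1 M. \<forall>\<epsilon>>0. \<exists>g\<in>D. L1_norm M (\<lambda>x. f x - g x) < \<epsilon>))"

definition L1_schauder_basis :: "'a measure \<Rightarrow> (nat \<Rightarrow> 'a \<Rightarrow> real) \<Rightarrow> bool" where
  "L1_schauder_basis M b \<longleftrightarrow>
    (\<forall>n. b n \<in> L1 M) \<and>
    (\<forall>f\<in>L1 M. \<exists>!a :: nat \<Rightarrow> real.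
      (\<lambda>N. L1_norm M (\<lambda>x. f x - (\<Sum>n<N. a n * b n x))) \<longlonglongrightarrow> 0)"

(* An ordinary basis b 0, ..., b (d - 1) of a finite-dimensional L_1(M). Coefficient families
   are taken in the extensional function space so that uniqueness only concerns the indices
   below d; d = 0 is the case of the zero space. *)
definition L1_finite_basis :: "'a measure \<Rightarrow> nat \<Rightarrow> (nat \<Rightarrow> 'a \<Rightarrow> real) \<Rightarrow> bool" where
  "L1_finite_basis M d b \<longleftrightarrow>
    (\<forall>n<d. b n \<in> L1 M) \<and>
    (\<forall>f\<in>L1 M. \<exists>!a. a \<in> {..<d} \<rightarrow>\<^sub>E (UNIV :: real set) \<and>
      (AE x in M. f x = (\<Sum>n<d. a n * b n x)))"

definition nonneg_ae :: "'a measure \<Rightarrow> ('a \<Rightarrow> real) \<Rightarrow> bool" where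
  "nonneg_ae M f \<longleftrightarrow> (AE x in M. 0 \<le> f x)"

end

theory Submission
  imports Defs
begin

text \<open>
  Let \<open>E 0\<close>, \<open>E 1\<close>, \<open>\<dots>\<close> be disjoint sets of positive finite measure, and let \<open>h 0\<close>, \<open>h 1\<close>, \<open>\<dots>\<close> be a
  Haar system inside them: \<open>h k\<close> has norm one and mean zero, lives in a single set \<open>E (J k)\<close>, and all
  earlier functions are constant on its support. Partial sums of such a system have increasing
  norms (\<open>haar_system_monotone\<close>), so the system is basic, but its members change sign. With \<open>e k\<close> the
  normalized indicator of \<open>E k\<close> put \<open>z k = \<bar>h k\<bar> + 2 * e k\<close>. The functions \<open>h k + z k\<close> and \<open>z k\<close> are
  non-negative, and the basis consists of these pairs, in their natural order.

  It is basic because the \<open>z k\<close> behave like unit vectors of \<open>l\<^sub>1\<close>, even modulo the \<open>h k\<close>. In a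
  combination of the \<open>h k\<close> and \<open>z k\<close> let \<open>c k\<close> be the coefficient of \<open>z k\<close>. Integration over \<open>E j\<close>
  gives \<open>2 * c j\<close> plus the sum of those \<open>c k\<close> with \<open>J k = j\<close>. Every \<open>c k\<close> thus occurs once with weight
  two and once with weight one, and the sum of all \<open>\<bar>c k\<bar>\<close> is at most the norm of the combination
  (\<open>sum_coeff_le\<close>). This bounds the two parts of the combination separately, and the criterion
  \<open>L1_schauder_basis_criterion\<close> applies once the system is known to be total.

  It is total for the same reason. The difference \<open>\<bar>h k\<bar> - e (J k)\<close> is a combination of Haar functions,
  so modulo the closed span of the system \<open>e k\<close> equals \<open>-1/2\<close> times \<open>e (J k)\<close>. Iterating this
  replacement shows that every \<open>e k\<close> belongs to the closed span (\<open>e_in_closed_subspace\<close>). With the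
  \<open>e k\<close> and the Haar functions at hand, all cells of the Haar tree are obtained.

  A separable space \<open>L1 M\<close> has a sequence of sets \<open>A n\<close> of finite measure whose indicators are total
  (\<open>L1_separable_total_sequence\<close>). If the size of disjoint families of sets of positive finite measure
  is bounded, then finitely many atoms carry all integrable functions and their indicators form a
  finite basis (\<open>finite_nonneg_basis\<close>). Otherwise there is an infinite disjoint sequence of such
  sets; from it one builds the sets \<open>E j\<close>, and cutting them successively with the \<open>A n\<close> gives the
  Haar system (\<open>nonneg_schauder_basis_if_total\<close>). On the half-line both sequences consist of
  intervals.
\<close>

section \<open>The seminorm of $L_1$ and closed subspaces\<close>

lemma L1_integrable: "f \<in> L1 M \<Longrightarrow> integrable M f"
  by (simp add: L1_def)

lemma L1_zero [simp]: "(\<lambda>x. 0) \<in> L1 M"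
  by (simp add: L1_def)

lemma L1_add: "f \<in> L1 M \<Longrightarrow> g \<in> L1 M \<Longrightarrow> (\<lambda>x. f x + g x) \<in> L1 M"
  by (simp add: L1_def)

lemma L1_diff: "f \<in> L1 M \<Longrightarrow> g \<in> L1 M \<Longrightarrow> (\<lambda>x. f x - g x) \<in> L1 M"
  by (simp add: L1_def)

lemma L1_scale: "f \<in> L1 M \<Longrightarrow> (\<lambda>x. c * f x) \<in> L1 M" for c :: real
  by (simp add: L1_def)

lemma L1_abs: "f \<in> L1 M \<Longrightarrow> (\<lambda>x. \<bar>f x\<bar>) \<in> L1 M"
  by (simp add: L1_def)

lemma L1_sum: "(\<And>i. i \<in> I \<Longrightarrow> f i \<in> L1 M) \<Longrightarrow> (\<lambda>x. \<Sum>i\<in>I. f i x) \<in> L1 M"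
  by (simp add: L1_def)

lemma L1_indicator: "B \<in> sets M \<Longrightarrow> emeasure M B < \<infinity> \<Longrightarrow> indicat_real B \<in> L1 M"
  by (simp add: L1_def)

lemma L1_norm_nonneg [simp]: "0 \<le> L1_norm M f"
  by (simp add: L1_norm_def)

lemma L1_norm_zero [simp]: "L1_norm M (\<lambda>x. 0) = 0"
  by (simp add: L1_norm_def)

lemma L1_norm_scale: "L1_norm M (\<lambda>x. c * f x) = \<bar>c\<bar> * L1_norm M f" for c :: real
  by (simp add: L1_norm_def abs_mult)

lemma L1_norm_minus_commute: "L1_norm M (\<lambda>x. f x - g x) = L1_norm M (\<lambda>x. g x - f x)"
  by (simp add: L1_norm_def abs_minus_commute)

lemma L1_norm_triangle:
  assumes "f \<in> L1 M" "g \<in> L1 M"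
  shows "L1_norm M (\<lambda>x. f x + g x) \<le> L1_norm M f + L1_norm M g"
proof -
  have "L1_norm M (\<lambda>x. f x + g x) \<le> (\<integral>x. \<bar>f x\<bar> + \<bar>g x\<bar> \<partial>M)"
    unfolding L1_norm_def using assms by (intro integral_mono) (auto simp: L1_def)
  also have "\<dots> = L1_norm M f + L1_norm M g"
    unfolding L1_norm_def using assms by (intro Bochner_Integration.integral_add) (auto simp: L1_def)
  finally show ?thesis .
qed

lemma L1_norm_triangle_diff:
  assumes "f \<in> L1 M" "g \<in> L1 M"
  shows "L1_norm M (\<lambda>x. f x - g x) \<le> L1_norm M f + L1_norm M g"
  using L1_norm_triangle[OF assms(1) L1_scale[OF assms(2), of "-1"]]
    L1_norm_scale[of M "-1" g] by simp

lemma L1_norm_dist_triangle: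
  assumes "f \<in> L1 M" "g \<in> L1 M" "h \<in> L1 M"
  shows "L1_norm M (\<lambda>x. f x - h x) \<le> L1_norm M (\<lambda>x. f x - g x) + L1_norm M (\<lambda>x. g x - h x)"
  using L1_norm_triangle[OF L1_diff[OF assms(1,2)] L1_diff[OF assms(2,3)]] by simp

lemma L1_norm_sum_le:
  assumes "\<And>i. i \<in> I \<Longrightarrow> f i \<in> L1 M"
  shows "L1_norm M (\<lambda>x. \<Sum>i\<in>I. f i x) \<le> (\<Sum>i\<in>I. L1_norm M (f i))"
  using assms
proof (induction I rule: infinite_finite_induct)
  case (insert i I)
  have "L1_norm M (\<lambda>x. f i x + (\<Sum>i\<in>I. f i x)) \<le> L1_norm M (f i) + L1_norm M (\<lambda>x. \<Sum>i\<in>I. f i x)"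
    using insert.prems by (intro L1_norm_triangle L1_sum) auto
  then show ?case
    using insert by fastforce
qed auto

lemma L1_norm_cong_AE:
  assumes "f \<in> L1 M" "g \<in> L1 M" "AE x in M. f x = g x"
  shows "L1_norm M (\<lambda>x. f x - g x) = 0"
proof -
  have "L1_norm M (\<lambda>x. f x - g x) = (\<integral>x. 0 \<partial>M)"
    unfolding L1_norm_def using assms by (intro integral_cong_AE) (auto simp: L1_def)
  then show ?thesis by simp
qed

lemma AE_not_in_measure_zero:
  assumes "B \<in> sets M" "emeasure M B < \<infinity>" "measure M B = 0"
  shows "AE x in M. x \<notin> B"
  using assms by (intro AE_not_in null_setsI) (auto simp: measure_def enn2real_eq_0_iff)

text \<open>Closed subspaces are sets of representatives. The clause on limits also makes them invariant
  under changes on null sets, since almost everywhere equal functions have distance zero.\<close>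
definition L1_closed_subspace :: "'a measure \<Rightarrow> ('a \<Rightarrow> real) set \<Rightarrow> bool" where
  "L1_closed_subspace M W \<longleftrightarrow>
    W \<subseteq> L1 M \<and> (\<lambda>x. 0) \<in> W \<and>
    (\<forall>f\<in>W. \<forall>g\<in>W. (\<lambda>x. f x + g x) \<in> W) \<and>
    (\<forall>f\<in>W. \<forall>c. (\<lambda>x. c * f x) \<in> W) \<and>
    (\<forall>f\<in>L1 M. (\<forall>\<epsilon>>0. \<exists>g\<in>W. L1_norm M (\<lambda>x. f x - g x) < \<epsilon>) \<longrightarrow> f \<in> W)"

definition L1_total :: "'a measure \<Rightarrow> ('a \<Rightarrow> real) set \<Rightarrow> bool" where
  "L1_total M G \<longleftrightarrow> (\<forall>W. L1_closed_subspace M W \<and> G \<subseteq> W \<longrightarrow> W = L1 M)"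

lemma L1_closed_subspaceI:
  assumes "W \<subseteq> L1 M" "(\<lambda>x. 0) \<in> W"
    and "\<And>f g. f \<in> W \<Longrightarrow> g \<in> W \<Longrightarrow> (\<lambda>x. f x + g x) \<in> W"
    and "\<And>f c. f \<in> W \<Longrightarrow> (\<lambda>x. c * f x) \<in> W"
    and "\<And>f. f \<in> L1 M \<Longrightarrow> (\<And>\<epsilon>. \<epsilon> > 0 \<Longrightarrow> \<exists>g\<in>W. L1_norm M (\<lambda>x. f x - g x) < \<epsilon>) \<Longrightarrow> f \<in> W"
  shows "L1_closed_subspace M W"
  using assms unfolding L1_closed_subspace_def by simp

context
  fixes M :: "'a measure" and W
  assumes W: "L1_closed_subspace M W"
begin

lemma closed_subspace_L1: "f \<in> W \<Longrightarrow> f \<in> L1 M"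
  using W by (auto simp: L1_closed_subspace_def)

lemma closed_subspace_zero: "(\<lambda>x. 0) \<in> W"
  using W by (auto simp: L1_closed_subspace_def)

lemma closed_subspace_add: "f \<in> W \<Longrightarrow> g \<in> W \<Longrightarrow> (\<lambda>x. f x + g x) \<in> W"
  using W by (auto simp: L1_closed_subspace_def)

lemma closed_subspace_scale: "f \<in> W \<Longrightarrow> (\<lambda>x. c * f x) \<in> W"
  using W by (auto simp: L1_closed_subspace_def)

lemma closed_subspace_diff: "f \<in> W \<Longrightarrow> g \<in> W \<Longrightarrow> (\<lambda>x. f x - g x) \<in> W"
  using closed_subspace_add[OF _ closed_subspace_scale, of f g "-1"] by simp

lemma closed_subspace_sum: "(\<And>i. i \<in> I \<Longrightarrow> f i \<in> W) \<Longrightarrow> (\<lambda>x. \<Sum>i\<in>I. f i x) \<in> W"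
  by (induction I rule: infinite_finite_induct)
    (auto intro: closed_subspace_zero closed_subspace_add)

lemma closed_subspace_closed:
  "f \<in> L1 M \<Longrightarrow> (\<And>\<epsilon>. \<epsilon> > 0 \<Longrightarrow> \<exists>g\<in>W. L1_norm M (\<lambda>x. f x - g x) < \<epsilon>) \<Longrightarrow> f \<in> W"
  using W by (auto simp: L1_closed_subspace_def)

lemma closed_subspace_limit:
  assumes "f \<in> L1 M" "\<And>i. g i \<in> W" "(\<lambda>i. L1_norm M (\<lambda>x. f x - g i x)) \<longlonglongrightarrow> 0"
  shows "f \<in> W"
proof (rule closed_subspace_closed[OF assms(1)])
  fix \<epsilon> :: real assume "\<epsilon> > 0"
  with assms(3) have "\<forall>\<^sub>F i in sequentially. L1_norm M (\<lambda>x. f x - g i x) < \<epsilon>"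
    by (simp add: order_tendsto_iff)
  then obtain i where "L1_norm M (\<lambda>x. f x - g i x) < \<epsilon>"
    by (auto simp: eventually_sequentially)
  with assms(2) show "\<exists>g\<in>W. L1_norm M (\<lambda>x. f x - g x) < \<epsilon>" by blast
qed

lemma closed_subspace_AE:
  assumes "f \<in> L1 M" "g \<in> W" "AE x in M. f x = g x"
  shows "f \<in> W"
  using closed_subspace_limit[of f "\<lambda>_. g"] assms closed_subspace_L1
  by (simp add: L1_norm_cong_AE)

text \<open>The remainder of the series of indicators is the indicator of a tail of a decreasing
  sequence of sets with empty intersection and finite measure, so its norm tends to zero.\<close>
lemma closed_subspace_indicator_UN:
  assumes B: "\<And>i. B i \<in> sets M" "disjoint_family B"
    and fin: "emeasure M (\<Union>i. B i) < \<infinity>"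
    and ind: "\<And>i. indicat_real (B i) \<in> W"
  shows "indicat_real (\<Union>i::nat. B i) \<in> W"
proof (rule closed_subspace_limit)
  let ?U = "\<Union>i. B i"
  let ?T = "\<lambda>n. \<Union>i<n. B i"
  have T: "?T n \<in> sets M" for n using B by auto
  have U: "?U \<in> sets M" using B by auto
  show "indicat_real ?U \<in> L1 M" using U fin by (rule L1_indicator)
  show "(\<lambda>x. \<Sum>i<n. indicat_real (B i) x) \<in> W" for n
    by (intro closed_subspace_sum ind)
  have sum: "(\<Sum>i<n. indicat_real (B i) x) = indicat_real (?T n) x" for n x
    by (rule indicator_UN_disjoint[symmetric])
       (use B(2) in \<open>auto simp: disjoint_family_on_def\<close>)
  have eq: "L1_norm M (\<lambda>x. indicat_real ?U x - (\<Sum>i<n. indicat_real (B i) x))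
      = measure M (?U - ?T n)" for n
  proof -
    have "L1_norm M (\<lambda>x. indicat_real ?U x - (\<Sum>i<n. indicat_real (B i) x))
       = (\<integral>x. indicat_real (?U - ?T n) x \<partial>M)"
      unfolding L1_norm_def sum
      by (intro Bochner_Integration.integral_cong) (auto split: split_indicator)
    also have "\<dots> = measure M (?U - ?T n)"
      using U T by (simp add: Int_absorb1 sets.sets_into_space Diff_subset subset_trans)
    finally show ?thesis .
  qed
  have "(\<lambda>n. measure M (?T n)) \<longlonglongrightarrow> measure M (\<Union>n. ?T n)"
  proof (rule Lim_measure_incseq)
    show "range ?T \<subseteq> sets M" using T by auto
    show "incseq ?T" by (rule monoI) (force dest: less_le_trans)
    have "(\<Union>n. ?T n) = ?U" by blast
    then show "emeasure M (\<Union>n. ?T n) \<noteq> \<infinity>" using fin by simp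
  qed
  moreover have "(\<Union>n. ?T n) = ?U" by blast
  ultimately have "(\<lambda>n. measure M (?T n)) \<longlonglongrightarrow> measure M ?U" by (simp only:)
  then have "(\<lambda>n. measure M ?U - measure M (?T n)) \<longlonglongrightarrow> measure M ?U - measure M ?U"
    by (intro tendsto_diff tendsto_const)
  moreover have "measure M (?U - ?T n) = measure M ?U - measure M (?T n)" for n
    using U T fin by (intro measure_Diff) auto
  ultimately show "(\<lambda>n. L1_norm M (\<lambda>x. indicat_real ?U x - (\<Sum>i<n. indicat_real (B i) x))) \<longlonglongrightarrow> 0"
    unfolding eq by simp
qed

end

section \<open>A criterion for Schauder bases\<close>

lemma L1_span_closure:
  fixes b :: "nat \<Rightarrow> 'a \<Rightarrow> real"
  assumes b: "\<And>n. b n \<in> L1 M"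
  shows "L1_closed_subspace M
    {f \<in> L1 M. \<forall>\<epsilon>>0. \<exists>N a. L1_norm M (\<lambda>x. f x - (\<Sum>n<N. a n * b n x)) < \<epsilon>}"
    (is "L1_closed_subspace M ?W")
proof (rule L1_closed_subspaceI)
  have comb: "(\<lambda>x. \<Sum>n<N. a n * b n x) \<in> L1 M" for N :: nat and a
    by (intro L1_sum L1_scale b)
  show "?W \<subseteq> L1 M" by blast
  show "(\<lambda>x. 0) \<in> ?W"
    by (auto intro!: exI[of _ 0])
  show "(\<lambda>x. f x + g x) \<in> ?W" if f: "f \<in> ?W" and g: "g \<in> ?W" for f g
  proof -
    have "\<exists>N a. L1_norm M (\<lambda>x. f x + g x - (\<Sum>n<N. a n * b n x)) < \<epsilon>" if "\<epsilon> > 0" for \<epsilon>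
    proof -
      obtain N a where Na: "L1_norm M (\<lambda>x. f x - (\<Sum>n<N. a n * b n x)) < \<epsilon>/2"
        using f \<open>\<epsilon> > 0\<close> by (auto dest!: spec[of _ "\<epsilon>/2"])
      obtain N' a' where Na': "L1_norm M (\<lambda>x. g x - (\<Sum>n<N'. a' n * b n x)) < \<epsilon>/2"
        using g \<open>\<epsilon> > 0\<close> by (auto dest!: spec[of _ "\<epsilon>/2"])
      let ?c = "\<lambda>n. (if n < N then a n else 0) + (if n < N' then a' n else 0)"
      have cut: "(\<Sum>n<N + N'. (if n < L then d n else 0) * b n x) = (\<Sum>n<L. d n * b n x)"
        if "L \<le> N + N'" for L and d :: "nat \<Rightarrow> real" and x
        by (rule sum.mono_neutral_cong_right) (use that in auto)
      have "(\<Sum>n<N + N'. ?c n * b n x) = (\<Sum>n<N. a n * b n x) + (\<Sum>n<N'. a' n * b n x)" for x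
        by (simp only: distrib_right sum.distrib) (simp add: cut)
      then have "(\<lambda>x. f x + g x - (\<Sum>n<N + N'. ?c n * b n x))
          = (\<lambda>x. (f x - (\<Sum>n<N. a n * b n x)) + (g x - (\<Sum>n<N'. a' n * b n x)))"
        by (intro ext) simp
      moreover have "L1_norm M \<dots> \<le> L1_norm M (\<lambda>x. f x - (\<Sum>n<N. a n * b n x))
          + L1_norm M (\<lambda>x. g x - (\<Sum>n<N'. a' n * b n x))"
        using f g comb by (intro L1_norm_triangle L1_diff) auto
      ultimately have "L1_norm M (\<lambda>x. f x + g x - (\<Sum>n<N + N'. ?c n * b n x)) < \<epsilon>"
        using Na Na' by simp
      then show ?thesis by (intro exI[of _ "N + N'"] exI[of _ ?c])
    qed
    then show ?thesis using f g by (auto intro: L1_add)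
  qed
  show "(\<lambda>x. c * f x) \<in> ?W" if f: "f \<in> ?W" for f and c :: real
  proof -
    have "\<exists>N a. L1_norm M (\<lambda>x. c * f x - (\<Sum>n<N. a n * b n x)) < \<epsilon>" if "\<epsilon> > 0" for \<epsilon>
    proof -
      have "\<epsilon> / (\<bar>c\<bar> + 1) > 0" using \<open>\<epsilon> > 0\<close> by simp
      then obtain N a where Na: "L1_norm M (\<lambda>x. f x - (\<Sum>n<N. a n * b n x)) < \<epsilon> / (\<bar>c\<bar> + 1)"
        using f by blast
      have "(\<lambda>x. c * f x - (\<Sum>n<N. c * a n * b n x)) = (\<lambda>x. c * (f x - (\<Sum>n<N. a n * b n x)))"
        by (simp add: sum_distrib_left algebra_simps)
      then have "L1_norm M (\<lambda>x. c * f x - (\<Sum>n<N. c * a n * b n x))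
          = \<bar>c\<bar> * L1_norm M (\<lambda>x. f x - (\<Sum>n<N. a n * b n x))"
        by (simp only: L1_norm_scale)
      also have "\<dots> \<le> (\<bar>c\<bar> + 1) * L1_norm M (\<lambda>x. f x - (\<Sum>n<N. a n * b n x))"
        by (intro mult_right_mono) auto
      also have "\<dots> < \<epsilon>" using Na by (simp add: field_simps)
      finally show ?thesis by (auto intro!: exI[of _ N] exI[of _ "\<lambda>n. c * a n"])
    qed
    then show ?thesis using f by (auto intro: L1_scale)
  qed
  show "f \<in> ?W"
    if f: "f \<in> L1 M" and lim: "\<And>\<epsilon>. \<epsilon> > 0 \<Longrightarrow> \<exists>g\<in>?W. L1_norm M (\<lambda>x. f x - g x) < \<epsilon>" for f
  proof -
    have "\<exists>N a. L1_norm M (\<lambda>x. f x - (\<Sum>n<N. a n * b n x)) < \<epsilon>" if "\<epsilon> > 0" for \<epsilon>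
    proof -
      obtain g where g: "g \<in> ?W" "L1_norm M (\<lambda>x. f x - g x) < \<epsilon>/2"
        using lim[of "\<epsilon>/2"] \<open>\<epsilon> > 0\<close> by force
      obtain N a where Na: "L1_norm M (\<lambda>x. g x - (\<Sum>n<N. a n * b n x)) < \<epsilon>/2"
        using g(1) \<open>\<epsilon> > 0\<close> by (auto dest!: spec[of _ "\<epsilon>/2"])
      have "L1_norm M (\<lambda>x. f x - (\<Sum>n<N. a n * b n x)) \<le> L1_norm M (\<lambda>x. f x - g x)
          + L1_norm M (\<lambda>x. g x - (\<Sum>n<N. a n * b n x))"
        using f g comb by (intro L1_norm_dist_triangle) auto
      also have "\<dots> < \<epsilon>" using g(2) Na by simp
      finally show ?thesis by blast
    qed
    then show ?thesis using f by auto
  qed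
qed

lemma L1_total_approx:
  fixes b :: "nat \<Rightarrow> 'a \<Rightarrow> real"
  assumes b: "\<And>n. b n \<in> L1 M" and tot: "L1_total M (range b)"
    and f: "f \<in> L1 M" and \<epsilon>: "\<epsilon> > 0"
  shows "\<exists>N a. L1_norm M (\<lambda>x. f x - (\<Sum>n<N. a n * b n x)) < \<epsilon>"
proof -
  let ?W = "{f \<in> L1 M. \<forall>\<epsilon>>0. \<exists>N a. L1_norm M (\<lambda>x. f x - (\<Sum>n<N. a n * b n x)) < \<epsilon>}"
  have "b n \<in> ?W" for n
  proof -
    have "(\<Sum>k<Suc n. (if k = n then 1 else 0) * b k x) = b n x" for x
      by (simp add: if_distrib[of "\<lambda>c. c * _"])
    then have "L1_norm M (\<lambda>x. b n x - (\<Sum>k<Suc n. (if k = n then 1 else 0) * b k x)) = 0"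
      by simp
    then have "\<forall>\<epsilon>>0. \<exists>N a. L1_norm M (\<lambda>x. b n x - (\<Sum>k<N. a k * b k x)) < \<epsilon>"
      by metis
    then show ?thesis using b by simp
  qed
  then have "range b \<subseteq> ?W" by (rule image_subsetI)
  with tot L1_span_closure[of b, OF b] have "?W = L1 M"
    unfolding L1_total_def by (metis (no_types, lifting))
  with f \<epsilon> show ?thesis by blast
qed

text \<open>This is the criterion of Grunblum. The bound on partial sums makes each coefficient of a finite
  combination a bounded functional of the combination. Hence the coefficients of finite
  combinations approximating \<open>f\<close> converge, and the same bound, passed to the limit, shows that the
  partial sums with the limit coefficients stay as close to \<open>f\<close> as the approximations are.
  Uniqueness is the same bound applied to a difference of two expansions.\<close>
lemma L1_schauder_basis_criterion:
  fixes b :: "nat \<Rightarrow> 'a \<Rightarrow> real"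
  assumes b: "\<And>n. b n \<in> L1 M" and nz: "\<And>n. L1_norm M (b n) > 0"
    and K: "\<And>a m N. m \<le> N \<Longrightarrow>
      L1_norm M (\<lambda>x. \<Sum>n<m. a n * b n x) \<le> K * L1_norm M (\<lambda>x. \<Sum>n<N. a n * b n x)"
    and tot: "L1_total M (range b)"
  shows "L1_schauder_basis M b"
proof -
  define S where "S a N = (\<lambda>x. \<Sum>n<N. a n * b n x)" for a and N :: nat
  have S_L1: "S a N \<in> L1 M" for a N
    unfolding S_def by (intro L1_sum L1_scale b)
  have S_diff: "S (\<lambda>n. a n - a' n) N = (\<lambda>x. S a N x - S a' N x)" for a a' N
    by (simp add: S_def sum_subtractf left_diff_distrib)
  have SK: "L1_norm M (S a m) \<le> K * L1_norm M (S a N)" if "m \<le> N" for a m N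
    using K[OF that] by (simp add: S_def)
  have K0: "K \<ge> 0"
    using SK[of 1 1 "\<lambda>_. 1"] nz[of 0] by (simp add: S_def not_less[symmetric])
  have coeff: "\<bar>a n\<bar> * L1_norm M (b n) \<le> 2 * K * L1_norm M (S a N)" if "n < N" for a n N
  proof -
    have "\<bar>a n\<bar> * L1_norm M (b n) = L1_norm M (\<lambda>x. S a (Suc n) x - S a n x)"
      by (simp add: S_def L1_norm_scale)
    also have "\<dots> \<le> L1_norm M (S a (Suc n)) + L1_norm M (S a n)"
      by (intro L1_norm_triangle_diff S_L1)
    also have "\<dots> \<le> K * L1_norm M (S a N) + K * L1_norm M (S a N)"
      using that by (intro add_mono SK) auto
    finally show ?thesis by simp
  qed
  have ex: "\<exists>a. (\<lambda>N. L1_norm M (\<lambda>x. f x - S a N x)) \<longlonglongrightarrow> 0" if f: "f \<in> L1 M" for f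
  proof -
    have "\<exists>p L. (\<forall>N\<ge>L. L1_norm M (\<lambda>x. f x - S p N x) < \<epsilon>)" if \<epsilon>: "\<epsilon> > 0" for \<epsilon>
    proof -
      obtain N a where Na: "L1_norm M (\<lambda>x. f x - (\<Sum>n<N. a n * b n x)) < \<epsilon>"
        using L1_total_approx[OF b tot f \<epsilon>] by blast
      have "S (\<lambda>n. if n < N then a n else 0) N' = (\<lambda>x. \<Sum>n<N. a n * b n x)" if "N' \<ge> N" for N'
        unfolding S_def by (rule ext, rule sum.mono_neutral_cong_right) (use that in auto)
      with Na show ?thesis by metis
    qed
    \<comment> \<open>\<open>p i\<close> has finitely many nonzero coefficients, so its partial sums are constant from \<open>L i\<close> on.\<close>
    then have "\<forall>i. \<exists>p L. (\<forall>N\<ge>L. L1_norm M (\<lambda>x. f x - S p N x) < 1 / real (Suc i))"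
      by simp
    then obtain p L where pL:
      "\<And>i N. N \<ge> L i \<Longrightarrow> L1_norm M (\<lambda>x. f x - S (p i) N x) < 1 / real (Suc i)"
      by metis
    let ?r = "\<lambda>i. 1 / real (Suc i)"
    have r0: "?r \<longlonglongrightarrow> 0" by (rule LIMSEQ_Suc) (rule lim_1_over_n)
    have dist: "L1_norm M (S (\<lambda>n. p i n - p k n) N) \<le> ?r i + ?r k" if "N \<ge> L i" "N \<ge> L k" for i k N
    proof -
      have "L1_norm M (S (\<lambda>n. p i n - p k n) N)
         \<le> L1_norm M (\<lambda>x. S (p i) N x - f x) + L1_norm M (\<lambda>x. f x - S (p k) N x)"
        unfolding S_diff by (intro L1_norm_dist_triangle S_L1 f)
      then show ?thesis
        using pL[OF that(1)] pL[OF that(2)] by (simp add: L1_norm_minus_commute[of M f])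
    qed
    have "convergent (\<lambda>i. p i n)" for n
    proof (rule Cauchy_convergent, rule metric_CauchyI)
      fix e :: real assume "e > 0"
      \<comment> \<open>The coefficient of \<open>b n\<close> in a combination of norm at most \<open>2 * (e / ?c)\<close> is below \<open>e\<close>.\<close>
      let ?c = "4 * (K + 1) / L1_norm M (b n)"
      have c: "?c > 0" using K0 nz[of n] by simp
      have "\<forall>\<^sub>F i in sequentially. ?r i < e / ?c"
        by (rule order_tendstoD(2)[OF r0 divide_pos_pos[OF \<open>e > 0\<close> c]])
      then obtain I where I: "\<And>i. i \<ge> I \<Longrightarrow> ?r i < e / ?c"
        by (auto simp: eventually_sequentially)
      have "dist (p i n) (p k n) < e" if ik: "i \<ge> I" "k \<ge> I" for i k
      proof -
        define N where "N = max (Suc n) (max (L i) (L k))"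
        have N: "n < N" "L i \<le> N" "L k \<le> N" by (auto simp: N_def)
        have "\<bar>p i n - p k n\<bar> * L1_norm M (b n) \<le> 2 * K * L1_norm M (S (\<lambda>n. p i n - p k n) N)"
          using coeff[OF N(1), of "\<lambda>n. p i n - p k n"] by simp
        also have "\<dots> \<le> 2 * K * (?r i + ?r k)"
          using dist[OF N(2,3)] K0 by (intro mult_left_mono) auto
        also have "\<dots> \<le> 2 * (K + 1) * (?r i + ?r k)"
          by (intro mult_right_mono) auto
        also have "\<dots> < 2 * (K + 1) * (e / ?c + e / ?c)"
          by (rule mult_strict_left_mono[OF add_strict_mono[OF I[OF ik(1)] I[OF ik(2)]]])
            (use K0 in simp)
        also have "\<dots> = e * L1_norm M (b n)"
        proof -
          have eq: "2 * q * (e / (4 * q / l) + e / (4 * q / l)) = e * l" if "q > 0" "l > 0" for q l :: real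
            using that by (simp add: field_simps)
          show ?thesis by (rule eq) (use K0 nz[of n] in auto)
        qed
        finally show ?thesis
          using nz[of n] by (simp add: dist_real_def)
      qed
      then show "\<exists>I. \<forall>i\<ge>I. \<forall>k\<ge>I. dist (p i n) (p k n) < e" by blast
    qed
    then have "\<forall>n. \<exists>l. (\<lambda>i. p i n) \<longlonglongrightarrow> l"
      by (simp add: convergent_def)
    from choice[OF this] obtain a where a: "\<And>n. (\<lambda>i. p i n) \<longlonglongrightarrow> a n"
      by blast
    have close: "L1_norm M (\<lambda>x. S (p i) N x - S a N x) \<le> K * ?r i" for i N
    proof (rule LIMSEQ_le_const)
      let ?R = "\<lambda>k. K * (?r i + ?r k) + (\<Sum>n<N. \<bar>p k n - a n\<bar> * L1_norm M (b n))"
      have "?R \<longlonglongrightarrow> K * (?r i + 0) + (\<Sum>n<N. \<bar>a n - a n\<bar> * L1_norm M (b n))"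
        by (intro tendsto_intros r0 a)
      then show "?R \<longlonglongrightarrow> K * ?r i" by simp
      have "L1_norm M (\<lambda>x. S (p i) N x - S a N x) \<le> ?R k" for k
      proof -
        define N' where "N' = max N (max (L i) (L k))"
        have N': "N \<le> N'" "L i \<le> N'" "L k \<le> N'" by (auto simp: N'_def)
        have "L1_norm M (\<lambda>x. S (p i) N x - S a N x) \<le> L1_norm M (\<lambda>x. S (p i) N x - S (p k) N x)
            + L1_norm M (\<lambda>x. S (p k) N x - S a N x)"
          by (intro L1_norm_dist_triangle S_L1)
        also have "L1_norm M (\<lambda>x. S (p i) N x - S (p k) N x) \<le> K * (?r i + ?r k)"
          using SK[OF N'(1), of "\<lambda>n. p i n - p k n"] dist[OF N'(2,3)] K0
          unfolding S_diff[symmetric] by (meson mult_left_mono order_trans)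
        also have "L1_norm M (\<lambda>x. S (p k) N x - S a N x)
            \<le> (\<Sum>n<N. L1_norm M (\<lambda>x. (p k n - a n) * b n x))"
          unfolding S_diff[symmetric] unfolding S_def by (intro L1_norm_sum_le L1_scale b)
        also have "\<dots> = (\<Sum>n<N. \<bar>p k n - a n\<bar> * L1_norm M (b n))"
          by (simp add: L1_norm_scale)
        finally show ?thesis by simp
      qed
      then show "\<exists>I. \<forall>k\<ge>I. L1_norm M (\<lambda>x. S (p i) N x - S a N x) \<le> ?R k" by blast
    qed
    have "(\<lambda>N. L1_norm M (\<lambda>x. f x - S a N x)) \<longlonglongrightarrow> 0"
    proof (rule LIMSEQ_I)
      fix e :: real assume "e > 0"
      then have "\<forall>\<^sub>F i in sequentially. ?r i < e / (1 + K)"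
        using r0 K0 by (intro order_tendstoD(2)) auto
      then obtain i where i: "?r i < e / (1 + K)"
        by (auto simp: eventually_sequentially)
      have "L1_norm M (\<lambda>x. f x - S a N x) < e" if "N \<ge> L i" for N
      proof -
        have "L1_norm M (\<lambda>x. f x - S a N x)
            \<le> L1_norm M (\<lambda>x. f x - S (p i) N x) + L1_norm M (\<lambda>x. S (p i) N x - S a N x)"
          by (intro L1_norm_dist_triangle S_L1 f)
        also have "\<dots> \<le> ?r i + K * ?r i"
          using pL[OF that] close[of i N] by simp
        also have "\<dots> = (1 + K) * ?r i" by (simp add: add_divide_distrib)
        also have "\<dots> < e"
          using i K0 by (simp add: pos_less_divide_eq mult.commute)
        finally show ?thesis .
      qed
      then show "\<exists>N0. \<forall>N\<ge>N0. norm (L1_norm M (\<lambda>x. f x - S a N x) - 0) < e"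
        by auto
    qed
    then show ?thesis by blast
  qed
  have uniq: "a = a'"
    if f: "f \<in> L1 M" and lim: "(\<lambda>N. L1_norm M (\<lambda>x. f x - S a N x)) \<longlonglongrightarrow> 0"
      "(\<lambda>N. L1_norm M (\<lambda>x. f x - S a' N x)) \<longlonglongrightarrow> 0" for f a a'
  proof
    fix n
    let ?d = "\<lambda>n. a n - a' n"
    have "\<bar>?d n\<bar> * L1_norm M (b n) \<le> 0"
    proof (rule LIMSEQ_le_const)
      let ?R = "\<lambda>N. 2 * K * (L1_norm M (\<lambda>x. f x - S a N x) + L1_norm M (\<lambda>x. f x - S a' N x))"
      have "?R \<longlonglongrightarrow> 2 * K * (0 + 0)" by (intro tendsto_intros lim)
      then show "?R \<longlonglongrightarrow> 0" by simp
      have "\<bar>?d n\<bar> * L1_norm M (b n) \<le> ?R N" if "N \<ge> Suc n" for N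
      proof -
        have "\<bar>?d n\<bar> * L1_norm M (b n) \<le> 2 * K * L1_norm M (S ?d N)"
          using coeff[of n N ?d] that by simp
        moreover have "L1_norm M (S ?d N)
            \<le> L1_norm M (\<lambda>x. S a N x - f x) + L1_norm M (\<lambda>x. f x - S a' N x)"
          unfolding S_diff by (intro L1_norm_dist_triangle S_L1 f)
        ultimately show ?thesis
          using K0 unfolding L1_norm_minus_commute[of M "S a N" f]
          by (meson mult_left_mono order_trans mult_nonneg_nonneg zero_le_numeral)
      qed
      then show "\<exists>N0. \<forall>N\<ge>N0. \<bar>?d n\<bar> * L1_norm M (b n) \<le> ?R N" by blast
    qed
    then show "a n = a' n"
      using nz[of n] by (simp add: mult_le_0_iff)
  qed
  show ?thesis
    unfolding L1_schauder_basis_def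
  proof (intro conjI allI ballI)
    show "b n \<in> L1 M" for n by (rule b)
    fix f assume "f \<in> L1 M"
    then show "\<exists>!a. (\<lambda>N. L1_norm M (\<lambda>x. f x - (\<Sum>n<N. a n * b n x))) \<longlonglongrightarrow> 0"
      using ex uniq unfolding S_def by blast
  qed
qed

section \<open>Perturbing a monotone mean-zero system into non-negative functions\<close>

text \<open>On \<open>C k\<close> the sum of the earlier terms is constant, so adding a mean-zero function supported
  there cannot decrease the integral of the absolute value.\<close>
lemma haar_system_monotone:
  fixes h :: "nat \<Rightarrow> 'a \<Rightarrow> real"
  assumes h: "\<And>k. h k \<in> L1 M"
    and supp: "\<And>k x. x \<notin> C k \<Longrightarrow> h k x = 0"
    and mean: "\<And>k. (\<integral>x. h k x \<partial>M) = 0"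
    and const: "\<And>i k x y. i < k \<Longrightarrow> x \<in> C k \<Longrightarrow> y \<in> C k \<Longrightarrow> h i x = h i y"
    and "m \<le> N"
  shows "L1_norm M (\<lambda>x. \<Sum>k<m. a k * h k x) \<le> L1_norm M (\<lambda>x. \<Sum>k<N. a k * h k x)"
  using \<open>m \<le> N\<close>
proof (induction N rule: dec_induct)
  case (step N)
  define g where "g = (\<lambda>x. \<Sum>k<N. a k * h k x)"
  have g: "g \<in> L1 M" unfolding g_def by (intro L1_sum L1_scale h)
  define s where "s = g (SOME y. y \<in> C N)"
  have s: "g x = s" if "x \<in> C N" for x
    unfolding s_def g_def
  proof (rule sum.cong)
    fix k assume "k \<in> {..<N}"
    then show "a k * h k x = a k * h k (SOME y. y \<in> C N)"
      using const[of k N x "SOME y. y \<in> C N"] that someI[of "\<lambda>y. y \<in> C N" x] by simp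
  qed simp
  let ?\<sigma> = "sgn s"
  \<comment> \<open>Test against the sign of the constant value: the new mean-zero term does not
    contribute to the resulting integral.\<close>
  have "L1_norm M g = (\<integral>x. \<bar>g x\<bar> + ?\<sigma> * (a N * h N x) \<partial>M)"
    unfolding L1_norm_def using g h[of N] mean[of N] by (simp add: L1_def)
  also have "\<dots> \<le> (\<integral>x. \<bar>g x + a N * h N x\<bar> \<partial>M)"
  proof (rule integral_mono)
    show "integrable M (\<lambda>x. \<bar>g x\<bar> + ?\<sigma> * (a N * h N x))"
      using g h[of N] by (simp add: L1_def)
    show "integrable M (\<lambda>x. \<bar>g x + a N * h N x\<bar>)"
      using g h[of N] by (simp add: L1_def)
    fix x
    show "\<bar>g x\<bar> + ?\<sigma> * (a N * h N x) \<le> \<bar>g x + a N * h N x\<bar>"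
    proof (cases "x \<in> C N")
      case True
      then show ?thesis using s[OF True] by (auto simp: sgn_real_def)
    qed (simp add: supp)
  qed
  finally have "L1_norm M g \<le> L1_norm M (\<lambda>x. \<Sum>k<Suc N. a k * h k x)"
    by (simp add: L1_norm_def g_def)
  then show ?case
    using step.IH unfolding g_def by linarith
qed simp

text \<open>The functions \<open>h k\<close> change sign and carry the mean-zero part of the space, the indicators of the
  sets \<open>E j\<close> carry the means. The new system \<open>b\<close> spans, in each pair \<open>b (2 * k)\<close>, \<open>b (2 * k + 1)\<close>,
  the same plane as \<open>h k\<close> and \<open>z k\<close>; the summand \<open>\<bar>h k\<bar>\<close> of \<open>z k\<close> is what makes \<open>h k + z k\<close>
  non-negative. The summand \<open>e k\<close> lives on a different set for each \<open>k\<close> and has weight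
  two, so that it dominates the mean one that \<open>\<bar>h k\<bar>\<close> contributes on \<open>E (J k)\<close>.\<close>
locale perturbed_haar =
  fixes M :: "'a measure" and E :: "nat \<Rightarrow> 'a set" and J :: "nat \<Rightarrow> nat"
    and h :: "nat \<Rightarrow> 'a \<Rightarrow> real"
  assumes E_sets: "\<And>j. E j \<in> sets M"
    and E_disj: "disjoint_family E"
    and E_fin: "\<And>j. emeasure M (E j) < \<infinity>"
    and E_pos: "\<And>j. measure M (E j) > 0"
    and h_L1: "\<And>k. h k \<in> L1 M"
    and h_norm: "\<And>k. L1_norm M (h k) = 1"
    and h_mean: "\<And>k. (\<integral>x. h k x \<partial>M) = 0"
    and h_supp: "\<And>k x. x \<notin> E (J k) \<Longrightarrow> h k x = 0"
    and h_mono: "\<And>a m N. m \<le> N \<Longrightarrow>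
      L1_norm M (\<lambda>x. \<Sum>k<m. a k * h k x) \<le> L1_norm M (\<lambda>x. \<Sum>k<N. a k * h k x)"
begin

definition e :: "nat \<Rightarrow> 'a \<Rightarrow> real" where
  "e j = (\<lambda>x. indicat_real (E j) x / measure M (E j))"

definition z :: "nat \<Rightarrow> 'a \<Rightarrow> real" where
  "z k = (\<lambda>x. \<bar>h k x\<bar> + 2 * e k x)"

definition b :: "nat \<Rightarrow> 'a \<Rightarrow> real" where
  "b n = (if even n then (\<lambda>x. h (n div 2) x + z (n div 2) x) else z (n div 2))"

lemma e_L1: "e j \<in> L1 M"
  using E_sets E_fin by (auto simp: e_def L1_def)

lemma z_L1: "z k \<in> L1 M"
  unfolding z_def by (intro L1_add L1_abs L1_scale h_L1 e_L1)

lemma b_L1: "b n \<in> L1 M"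
  by (auto simp: b_def intro: L1_add h_L1 z_L1)

lemma e_nonneg: "e j x \<ge> 0"
  by (simp add: e_def)

lemma z_nonneg: "z k x \<ge> 0"
  by (simp add: z_def e_nonneg)

lemma b_nonneg: "b n x \<ge> 0"
  using e_nonneg[of "n div 2" x] by (auto simp: b_def z_def)

lemma E_cap: "E i \<inter> E j = (if i = j then E i else {})"
  using E_disj by (auto simp: disjoint_family_on_def)

lemma integral_e_E: "(\<integral>x. indicat_real (E j) x * e k x \<partial>M) = (if j = k then 1 else 0)"
proof -
  have "(\<lambda>x. indicat_real (E j) x * e k x)
      = (\<lambda>x. (if j = k then 1 / measure M (E k) else 0) * indicat_real (E k) x)"
    using E_cap[of j k] by (auto simp: e_def fun_eq_iff split: split_indicator if_splits)
  then show ?thesis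
    using E_pos[of k] sets.sets_into_space[OF E_sets[of k]] by (simp add: Int_absorb2)
qed

lemma integral_e: "(\<integral>x. e k x \<partial>M) = 1"
  using E_pos[of k] sets.sets_into_space[OF E_sets[of k]] by (simp add: e_def Int_absorb2)

lemma integral_h_E: "(\<integral>x. indicat_real (E j) x * h k x \<partial>M) = 0"
proof -
  have "(\<lambda>x. indicat_real (E j) x * h k x) = (\<lambda>x. (if j = J k then 1 else 0) * h k x)"
    using E_cap[of j "J k"] h_supp[of _ k] by (auto simp: fun_eq_iff split: split_indicator if_splits)
  then show ?thesis by (simp add: h_mean)
qed

lemma integral_abs_h_E:
  "(\<integral>x. indicat_real (E j) x * \<bar>h k x\<bar> \<partial>M) = (if j = J k then 1 else 0)"
proof -
  have "(\<lambda>x. indicat_real (E j) x * \<bar>h k x\<bar>) = (\<lambda>x. (if j = J k then 1 else 0) * \<bar>h k x\<bar>)"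
    using E_cap[of j "J k"] h_supp[of _ k] by (auto simp: fun_eq_iff split: split_indicator if_splits)
  then show ?thesis using h_norm[of k] by (simp add: L1_norm_def)
qed

lemma integrable_E_mult: "f \<in> L1 M \<Longrightarrow> integrable M (\<lambda>x. indicat_real (E j) x * f x)"
  using integrable_mult_indicator[OF E_sets, of f j] by (simp add: L1_def)

lemma integral_z_E:
  "(\<integral>x. indicat_real (E j) x * z k x \<partial>M) = (if j = J k then 1 else 0) + (if j = k then 2 else 0)"
proof -
  have "(\<lambda>x. indicat_real (E j) x * z k x) =
      (\<lambda>x. indicat_real (E j) x * \<bar>h k x\<bar> + 2 * (indicat_real (E j) x * e k x))"
    by (simp add: z_def algebra_simps)
  then show ?thesis
    using integrable_E_mult[OF L1_abs[OF h_L1]] integrable_E_mult[OF e_L1]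
    by (simp add: integral_abs_h_E integral_e_E)
qed

lemma z_norm: "L1_norm M (z k) = 3"
proof -
  have "L1_norm M (z k) = (\<integral>x. \<bar>h k x\<bar> + 2 * e k x \<partial>M)"
    unfolding L1_norm_def using z_nonneg[of k] by (simp add: z_def)
  also have "\<dots> = (\<integral>x. \<bar>h k x\<bar> \<partial>M) + 2"
    using L1_abs[OF h_L1[of k]] e_L1[of k] by (simp add: L1_def integral_e)
  finally show ?thesis using h_norm[of k] by (simp add: L1_norm_def)
qed

lemma sum_integrals_E_le:
  assumes f: "f \<in> L1 M"
  shows "(\<Sum>j<p. \<bar>\<integral>x. indicat_real (E j) x * f x \<partial>M\<bar>) \<le> L1_norm M f"
proof -
  have "(\<Sum>j<p. \<bar>\<integral>x. indicat_real (E j) x * f x \<partial>M\<bar>)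
      \<le> (\<Sum>j<p. \<integral>x. indicat_real (E j) x * \<bar>f x\<bar> \<partial>M)"
  proof (rule sum_mono)
    fix j
    have "\<bar>\<integral>x. indicat_real (E j) x * f x \<partial>M\<bar> \<le> (\<integral>x. \<bar>indicat_real (E j) x * f x\<bar> \<partial>M)"
      by (rule integral_abs_bound)
    then show "\<bar>\<integral>x. indicat_real (E j) x * f x \<partial>M\<bar> \<le> (\<integral>x. indicat_real (E j) x * \<bar>f x\<bar> \<partial>M)"
      by (simp add: abs_mult)
  qed
  also have "\<dots> = (\<integral>x. (\<Sum>j<p. indicat_real (E j) x * \<bar>f x\<bar>) \<partial>M)"
    by (rule Bochner_Integration.integral_sum[symmetric]) (intro integrable_E_mult L1_abs f)
  also have "\<dots> \<le> (\<integral>x. \<bar>f x\<bar> \<partial>M)"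
  proof (rule integral_mono)
    show "integrable M (\<lambda>x. \<Sum>j<p. indicat_real (E j) x * \<bar>f x\<bar>)"
      by (intro Bochner_Integration.integrable_sum integrable_E_mult L1_abs f)
    show "integrable M (\<lambda>x. \<bar>f x\<bar>)" using f by (simp add: L1_def)
    fix x
    have "(\<Sum>j<p. indicat_real (E j) x) = indicat_real (\<Union>j<p. E j) x"
      by (rule indicator_UN_disjoint[symmetric])
        (use E_disj in \<open>auto simp: disjoint_family_on_def\<close>)
    also have "\<dots> \<le> 1" by (simp add: indicator_def)
    finally show "(\<Sum>j<p. indicat_real (E j) x * \<bar>f x\<bar>) \<le> \<bar>f x\<bar>"
      unfolding sum_distrib_right[symmetric] by (simp add: mult_left_le_one_le sum_nonneg)
  qed
  finally show ?thesis by (simp add: L1_norm_def)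
qed

text \<open>Finite combinations of \<open>b\<close>, in the coordinates given by \<open>h\<close> and \<open>z\<close>: a pair of coefficients of
  \<open>b\<close> contributes its first member to \<open>\<alpha>\<close> and its sum to \<open>c\<close>.\<close>
definition T :: "(nat \<Rightarrow> real) \<Rightarrow> (nat \<Rightarrow> real) \<Rightarrow> nat \<Rightarrow> 'a \<Rightarrow> real" where
  "T \<alpha> c p = (\<lambda>x. (\<Sum>k<p. \<alpha> k * h k x) + (\<Sum>k<p. c k * z k x))"

lemma sum_h_L1: "(\<lambda>x. \<Sum>k<p. \<alpha> k * h k x) \<in> L1 M" for p :: nat
  by (intro L1_sum L1_scale h_L1)

lemma sum_z_L1: "(\<lambda>x. \<Sum>k<p. c k * z k x) \<in> L1 M" for p :: nat
  by (intro L1_sum L1_scale z_L1)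

lemma T_L1: "T \<alpha> c p \<in> L1 M"
  unfolding T_def by (intro L1_add sum_h_L1 sum_z_L1)

lemma sum_z_norm_le: "L1_norm M (\<lambda>x. \<Sum>k<p. c k * z k x) \<le> 3 * (\<Sum>k<p. \<bar>c k\<bar>)" for p :: nat
proof -
  have "L1_norm M (\<lambda>x. \<Sum>k<p. c k * z k x) \<le> (\<Sum>k<p. L1_norm M (\<lambda>x. c k * z k x))"
    by (intro L1_norm_sum_le L1_scale z_L1)
  then show ?thesis by (simp add: L1_norm_scale z_norm sum_distrib_left mult.commute)
qed

lemma T_norm_le: "L1_norm M (T \<alpha> c p) \<le> L1_norm M (\<lambda>x. \<Sum>k<p. \<alpha> k * h k x) + 3 * (\<Sum>k<p. \<bar>c k\<bar>)"
  using L1_norm_triangle[OF sum_h_L1[of \<alpha> p] sum_z_L1[of c p]] sum_z_norm_le[of c p]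
  unfolding T_def by simp

lemma integral_T_E:
  assumes "j < p"
  shows "(\<integral>x. indicat_real (E j) x * T \<alpha> c p x \<partial>M) = (\<Sum>k<p. if J k = j then c k else 0) + 2 * c j"
proof -
  have "(\<lambda>x. indicat_real (E j) x * T \<alpha> c p x) =
     (\<lambda>x. (\<Sum>k<p. \<alpha> k * (indicat_real (E j) x * h k x)) + (\<Sum>k<p. c k * (indicat_real (E j) x * z k x)))"
    by (simp add: T_def distrib_left sum_distrib_left mult.left_commute)
  then have "(\<integral>x. indicat_real (E j) x * T \<alpha> c p x \<partial>M) =
     (\<Sum>k<p. c k * ((if j = J k then 1 else 0) + (if j = k then 2 else 0)))"
    using integrable_E_mult[OF h_L1] integrable_E_mult[OF z_L1]
    by (simp add: integral_h_E integral_z_E)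
  also have "\<dots> = (\<Sum>k<p. (if J k = j then c k else 0) + (if j = k then 2 * c k else 0))"
    by (intro sum.cong) auto
  also have "\<dots> = (\<Sum>k<p. if J k = j then c k else 0) + 2 * c j"
    using assms by (simp add: sum.distrib)
  finally show ?thesis .
qed

text \<open>The central estimate: the \<open>z k\<close> span a copy of \<open>l\<^sub>1\<close>, whatever multiples of the \<open>h k\<close> are added.
  Integration over \<open>E j\<close> kills every \<open>h k\<close> and leaves \<open>2 * c j\<close> plus all \<open>c k\<close> with \<open>J k = j\<close>. Summed
  over \<open>j\<close>, the first part has size \<open>2 * (\<Sum>k<p. \<bar>c k\<bar>)\<close> and the second at most half of that, since each
  \<open>k\<close> occurs in it at most once.\<close>
lemma sum_coeff_le: "(\<Sum>k<p. \<bar>c k\<bar>) \<le> L1_norm M (T \<alpha> c p)"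
proof -
  let ?s = "\<lambda>j. \<Sum>k<p. if J k = j then c k else 0"
  have "(\<Sum>j<p. \<bar>?s j\<bar>) \<le> (\<Sum>j<p. \<Sum>k<p. if J k = j then \<bar>c k\<bar> else 0)"
    by (intro sum_mono order_trans[OF sum_abs]) (simp add: if_distrib[of abs])
  also have "\<dots> = (\<Sum>k<p. \<Sum>j<p. if J k = j then \<bar>c k\<bar> else 0)"
    by (rule sum.swap)
  also have "\<dots> \<le> (\<Sum>k<p. \<bar>c k\<bar>)"
    by (intro sum_mono) simp
  finally have 1: "(\<Sum>j<p. \<bar>?s j\<bar>) \<le> (\<Sum>k<p. \<bar>c k\<bar>)" .
  have "2 * (\<Sum>j<p. \<bar>c j\<bar>) - (\<Sum>j<p. \<bar>?s j\<bar>) = (\<Sum>j<p. 2 * \<bar>c j\<bar> - \<bar>?s j\<bar>)"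
    by (simp add: sum_subtractf sum_distrib_left)
  also have "\<dots> \<le> (\<Sum>j<p. \<bar>?s j + 2 * c j\<bar>)"
    by (intro sum_mono) linarith
  also have "\<dots> = (\<Sum>j<p. \<bar>\<integral>x. indicat_real (E j) x * T \<alpha> c p x \<partial>M\<bar>)"
    by (intro sum.cong) (simp_all add: integral_T_E)
  also have "\<dots> \<le> L1_norm M (T \<alpha> c p)"
    by (intro sum_integrals_E_le T_L1)
  finally show ?thesis using 1 by simp
qed

lemma sum_h_norm_le: "L1_norm M (\<lambda>x. \<Sum>k<p. \<alpha> k * h k x) \<le> 4 * L1_norm M (T \<alpha> c p)"
proof -
  have "(\<lambda>x. \<Sum>k<p. \<alpha> k * h k x) = (\<lambda>x. T \<alpha> c p x - (\<Sum>k<p. c k * z k x))"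
    by (simp add: T_def)
  then have "L1_norm M (\<lambda>x. \<Sum>k<p. \<alpha> k * h k x)
      \<le> L1_norm M (T \<alpha> c p) + L1_norm M (\<lambda>x. \<Sum>k<p. c k * z k x)"
    using L1_norm_triangle_diff[OF T_L1 sum_z_L1] by simp
  then show ?thesis
    using sum_z_norm_le[of c p] sum_coeff_le[of c p \<alpha>] by linarith
qed

lemma coeff_h_le:
  assumes "k < p"
  shows "\<bar>\<alpha> k\<bar> \<le> 8 * L1_norm M (T \<alpha> c p)"
proof -
  let ?H = "\<lambda>m x. \<Sum>k<m. \<alpha> k * h k x"
  have "\<bar>\<alpha> k\<bar> = L1_norm M (\<lambda>x. ?H (Suc k) x - ?H k x)"
    by (simp add: L1_norm_scale h_norm)
  also have "\<dots> \<le> L1_norm M (?H (Suc k)) + L1_norm M (?H k)"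
    by (intro L1_norm_triangle_diff sum_h_L1)
  also have "\<dots> \<le> L1_norm M (?H p) + L1_norm M (?H p)"
    using assms by (intro add_mono h_mono) auto
  finally show ?thesis using sum_h_norm_le[of \<alpha> p c] by linarith
qed

lemma sum_b_pairs: "(\<Sum>n<2 * p. a n * b n x) = T (\<lambda>k. a (2 * k)) (\<lambda>k. a (2 * k) + a (2 * k + 1)) p x"
  by (induction p) (simp_all add: T_def b_def algebra_simps)

text \<open>Cutting the sum at \<open>m\<close> cuts the Haar part, at the cost of a factor 4, and cuts the coefficients
  of the \<open>z k\<close>, whose sum then is at most \<open>1 + 8\<close> times the norm, where 8 comes from a pair that is
  cut in the middle. As each \<open>z k\<close> has norm 3, the constant is \<open>4 + 3 * (1 + 8) = 31\<close>.\<close>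
lemma b_partial_sums:
  assumes "m \<le> N"
  shows "L1_norm M (\<lambda>x. \<Sum>n<m. a n * b n x) \<le> 31 * L1_norm M (\<lambda>x. \<Sum>n<N. a n * b n x)"
proof -
  define cut where "cut L n = (if n < L then a n else 0)" for L n :: nat
  define \<alpha> where "\<alpha> L k = cut L (2 * k)" for L k
  define c where "c L k = cut L (2 * k) + cut L (2 * k + 1)" for L k
  have T: "(\<lambda>x. \<Sum>n<L. a n * b n x) = T (\<alpha> L) (c L) N" if "L \<le> N" for L
  proof
    fix x
    have "(\<Sum>n<L. a n * b n x) = (\<Sum>n<2 * N. cut L n * b n x)"
      by (rule sum.mono_neutral_cong_left) (use that in \<open>auto simp: cut_def\<close>)
    then show "(\<Sum>n<L. a n * b n x) = T (\<alpha> L) (c L) N x"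
      unfolding \<alpha>_def c_def by (simp only: sum_b_pairs)
  qed
  let ?n = "L1_norm M (T (\<alpha> N) (c N) N)"
  define r where "r = (m + 1) div 2"
  have r: "r \<le> N" using \<open>m \<le> N\<close> by (auto simp: r_def)
  have \<alpha>_cut: "\<alpha> m k = (if k < r then \<alpha> N k else 0)" for k
  proof -
    have "k < r \<longleftrightarrow> 2 * k < m" unfolding r_def by linarith
    then show ?thesis using \<open>m \<le> N\<close> by (auto simp: \<alpha>_def cut_def)
  qed
  have "(\<lambda>x. \<Sum>k<N. \<alpha> m k * h k x) = (\<lambda>x. \<Sum>k<r. \<alpha> N k * h k x)"
    by (rule ext, rule sum.mono_neutral_cong_right) (use r in \<open>auto simp: \<alpha>_cut\<close>)
  then have H: "L1_norm M (\<lambda>x. \<Sum>k<N. \<alpha> m k * h k x) \<le> 4 * ?n"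
    using h_mono[OF r, of "\<alpha> N"] sum_h_norm_le[of "\<alpha> N" N "c N"] by simp
  \<comment> \<open>The cut splits at most one pair, and then leaves behind the coefficient of one \<open>h k\<close>.\<close>
  have "\<bar>c m k\<bar> \<le> \<bar>c N k\<bar> + (if k = m div 2 then \<bar>\<alpha> N k\<bar> else 0)" for k
  proof -
    consider "2 * k + 1 < m" | "2 * k + 1 = m" | "2 * k \<ge> m" by linarith
    then show ?thesis
      using \<open>m \<le> N\<close> by cases (auto simp: c_def \<alpha>_def cut_def)
  qed
  then have "(\<Sum>k<N. \<bar>c m k\<bar>) \<le> (\<Sum>k<N. \<bar>c N k\<bar> + (if k = m div 2 then \<bar>\<alpha> N k\<bar> else 0))"
    by (intro sum_mono)
  also have "\<dots> = (\<Sum>k<N. \<bar>c N k\<bar>) + (if m div 2 < N then \<bar>\<alpha> N (m div 2)\<bar> else 0)"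
    by (simp add: sum.distrib)
  also have "\<dots> \<le> ?n + 8 * ?n"
    by (intro add_mono sum_coeff_le) (auto intro: coeff_h_le)
  finally have "L1_norm M (T (\<alpha> m) (c m) N) \<le> 31 * ?n"
    using T_norm_le[of "\<alpha> m" "c m" N] H by linarith
  then show ?thesis using T[OF \<open>m \<le> N\<close>] T[of N] by simp
qed

lemma b_norm_pos: "L1_norm M (b n) > 0"
proof (cases "even n")
  case True
  let ?k = "n div 2"
  have "L1_norm M (b n) = (\<integral>x. b n x \<partial>M)"
    by (simp add: L1_norm_def b_nonneg)
  also have "\<dots> = (\<integral>x. z ?k x \<partial>M)"
    using True h_L1[of ?k] z_L1[of ?k] by (simp add: b_def h_mean L1_def)
  also have "\<dots> = L1_norm M (z ?k)"
    by (simp add: L1_norm_def z_nonneg)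
  finally show ?thesis by (simp add: z_norm)
qed (simp add: b_def z_norm)

text \<open>Modulo \<open>W\<close>, the function \<open>z k\<close> vanishes and \<open>\<bar>h k\<bar>\<close> equals \<open>e (J k)\<close>, so \<open>e k\<close> equals \<open>-1/2\<close> times
  \<open>e (J k)\<close>. Replacing \<open>e k\<close> in this way again and again leaves a remainder of norm \<open>(1/2) ^ i\<close>
  after \<open>i\<close> steps.\<close>
lemma e_in_closed_subspace:
  assumes W: "L1_closed_subspace M W" and bW: "range b \<subseteq> W"
    and hJ: "\<And>k. (\<lambda>x. \<bar>h k x\<bar> - e (J k) x) \<in> W"
  shows "e k \<in> W"
proof -
  have zW: "z k \<in> W" for k
  proof -
    have "b (2 * k + 1) \<in> W" using bW by blast
    then show ?thesis by (simp add: b_def)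
  qed
  have eJ: "(\<lambda>x. e k x + (1/2) * e (J k) x) \<in> W" for k
  proof -
    have "(\<lambda>x. (1/2) * (z k x - (\<bar>h k x\<bar> - e (J k) x))) \<in> W"
      by (intro closed_subspace_scale[OF W] closed_subspace_diff[OF W] zW hJ)
    then show ?thesis by (simp add: z_def add_divide_distrib)
  qed
  have approx: "\<exists>g\<in>W. L1_norm M (\<lambda>x. e k x - g x) \<le> (1/2) ^ i" for i
  proof (induction i arbitrary: k)
    case 0
    have "L1_norm M (\<lambda>x. e k x - 0) \<le> 1"
      using integral_e[of k] e_nonneg by (simp add: L1_norm_def)
    then show ?case using closed_subspace_zero[OF W] by force
  next
    case (Suc i)
    obtain g where g: "g \<in> W" "L1_norm M (\<lambda>x. e (J k) x - g x) \<le> (1/2) ^ i"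
      using Suc by blast
    let ?g = "\<lambda>x. (e k x + (1/2) * e (J k) x) - (1/2) * g x"
    have "?g \<in> W"
      by (intro closed_subspace_diff[OF W] closed_subspace_scale[OF W] eJ g)
    moreover have "(\<lambda>x. e k x - ?g x) = (\<lambda>x. (-1/2) * (e (J k) x - g x))"
      by (simp add: algebra_simps)
    then have "L1_norm M (\<lambda>x. e k x - ?g x) = (1/2) * L1_norm M (\<lambda>x. e (J k) x - g x)"
      by (simp only: L1_norm_scale)
    ultimately show ?case using g(2) by (intro bexI[of _ ?g]) auto
  qed
  show ?thesis
  proof (rule closed_subspace_closed[OF W e_L1])
    fix \<epsilon> :: real assume "\<epsilon> > 0"
    then obtain i where "(1/2) ^ i < \<epsilon>"
      using real_arch_pow_inv[of \<epsilon> "1/2"] by auto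
    then show "\<exists>g\<in>W. L1_norm M (\<lambda>x. e k x - g x) < \<epsilon>"
      using approx[of i] by force
  qed
qed

lemma h_in_closed_subspace:
  assumes W: "L1_closed_subspace M W" and bW: "range b \<subseteq> W"
  shows "h k \<in> W"
proof -
  have "b (2 * k) \<in> W" "b (2 * k + 1) \<in> W" using bW by auto
  from closed_subspace_diff[OF W this] show ?thesis by (simp add: b_def)
qed

lemma schauder_basis_b: "L1_total M (range b) \<Longrightarrow> L1_schauder_basis M b"
  by (rule L1_schauder_basis_criterion[OF b_L1 b_norm_pos b_partial_sums])

end

section \<open>Haar systems over a tree of cells\<close>

definition haar :: "'a measure \<Rightarrow> 'a set \<Rightarrow> 'a set \<Rightarrow> 'a \<Rightarrow> real" where
  "haar M L R = (\<lambda>x. indicat_real L x / (2 * measure M L) - indicat_real R x / (2 * measure M R))"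

lemma haar_swap: "haar M R L = (\<lambda>x. (-1) * haar M L R x)"
  by (simp add: haar_def)

lemma integral_indicator_eq_measure: "B \<in> sets M \<Longrightarrow> (\<integral>x. indicat_real B x \<partial>M) = measure M B"
  by (simp add: Int_absorb2 sets.sets_into_space)

context
  fixes M :: "'a measure" and L R
  assumes L: "L \<in> sets M" "emeasure M L < \<infinity>" and R: "R \<in> sets M" "emeasure M R < \<infinity>"
    and LR: "L \<inter> R = {}"
begin

lemma indicator_halves: "indicat_real (L \<union> R) x = indicat_real L x + indicat_real R x"
  using LR by (auto split: split_indicator)

lemma measure_halves: "measure M (L \<union> R) = measure M L + measure M R"
  using L R LR by (intro measure_Union) auto

lemma abs_haar:
  "\<bar>haar M L R x\<bar> = indicat_real L x / (2 * measure M L) + indicat_real R x / (2 * measure M R)"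
  using LR by (auto simp: haar_def split: split_indicator)

lemma haar_L1: "haar M L R \<in> L1 M"
  using L R by (auto simp: haar_def L1_def)

lemma haar_mean:
  assumes "measure M L > 0" "measure M R > 0"
  shows "(\<integral>x. haar M L R x \<partial>M) = 0"
proof -
  have "(\<integral>x. haar M L R x \<partial>M) = (\<integral>x. indicat_real L x \<partial>M) / (2 * measure M L)
      - (\<integral>x. indicat_real R x \<partial>M) / (2 * measure M R)"
    unfolding haar_def using L R by (subst Bochner_Integration.integral_diff) auto
  also have "\<dots> = 0"
    unfolding integral_indicator_eq_measure[OF L(1)] integral_indicator_eq_measure[OF R(1)]
    using assms by simp
  finally show ?thesis .
qed

lemma haar_norm:
  assumes "measure M L > 0" "measure M R > 0"
  shows "L1_norm M (haar M L R) = 1"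
proof -
  have "L1_norm M (haar M L R) = (\<integral>x. indicat_real L x \<partial>M) / (2 * measure M L)
      + (\<integral>x. indicat_real R x \<partial>M) / (2 * measure M R)"
    unfolding L1_norm_def abs_haar using L R by (subst Bochner_Integration.integral_add) auto
  also have "\<dots> = 1"
    unfolding integral_indicator_eq_measure[OF L(1)] integral_indicator_eq_measure[OF R(1)]
    using assms by simp
  finally show ?thesis .
qed

text \<open>The indicators of the halves \<open>L\<close> and \<open>R\<close> are combinations of the indicator of \<open>L \<union> R\<close> and of the
  Haar function of the split. Subtracting the right multiple of \<open>e\<close>, which in the application has
  integral one, turns all indicators into mean-zero functions, and the relation persists.\<close>
lemma centered_half_in_closed_subspace:
  assumes W: "L1_closed_subspace M W" and e: "e \<in> L1 M"
    and parent: "(\<lambda>x. indicat_real (L \<union> R) x - measure M (L \<union> R) * e x) \<in> W"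
    and split: "measure M L > 0 \<Longrightarrow> measure M R > 0 \<Longrightarrow> haar M L R \<in> W"
  shows "(\<lambda>x. indicat_real L x - measure M L * e x) \<in> W"
proof -
  have cL1: "(\<lambda>x. indicat_real L x - measure M L * e x) \<in> L1 M"
    using L by (intro L1_diff L1_scale e L1_indicator) auto
  consider "measure M L = 0" | "measure M R = 0" | "measure M L > 0" "measure M R > 0"
    using measure_nonneg[of M L] measure_nonneg[of M R] by linarith
  then show ?thesis
  proof cases
    case 1
    have "AE x in M. indicat_real L x - measure M L * e x = 0"
      using AE_not_in_measure_zero[OF L 1] by eventually_elim (simp add: 1)
    then show ?thesis
      by (rule closed_subspace_AE[OF W cL1 closed_subspace_zero[OF W]])
  next
    case 2
    have "AE x in M. indicat_real L x - measure M L * e x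
        = indicat_real (L \<union> R) x - measure M (L \<union> R) * e x"
      using AE_not_in_measure_zero[OF R 2] by eventually_elim (simp add: 2 indicator_halves measure_halves)
    then show ?thesis
      by (rule closed_subspace_AE[OF W cL1 parent])
  next
    case 3
    let ?l = "measure M L" and ?r = "measure M R"
    \<comment> \<open>The coefficients are chosen such that the indicator of \<open>R\<close> cancels.\<close>
    have comb: "(\<lambda>x. (2 * ?l * ?r / (?l + ?r)) * haar M L R x
        + (?l / (?l + ?r)) * (indicat_real (L \<union> R) x - measure M (L \<union> R) * e x)) \<in> W"
      by (intro closed_subspace_add[OF W] closed_subspace_scale[OF W] parent split 3)
    have identity: "(2 * l * r / (l + r)) * (s / (2 * l) - t / (2 * r))
        + (l / (l + r)) * (s + t - (l + r) * c) = s - l * c" if "l > 0" "r > 0" for l r s t c :: real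
    proof -
      have 1: "(2 * l * r / (l + r)) * (s / (2 * l) - t / (2 * r)) = (r * s - l * t) / (l + r)"
      proof -
        have "2 * l * r * (s / (2 * l) - t / (2 * r)) = r * s - l * t"
          using that by (simp add: right_diff_distrib)
        then show ?thesis by (simp only: times_divide_eq_left)
      qed
      have 2: "(l / (l + r)) * (s + t - (l + r) * c) = (l * s + l * t) / (l + r) - l * c"
        using that by (simp add: field_simps)
      have 3: "(r * s - l * t) / (l + r) + (l * s + l * t) / (l + r) = s"
      proof -
        have "r * s - l * t + (l * s + l * t) = s * (l + r)"
          by (simp add: algebra_simps)
        then show ?thesis
          using that by (simp only: add_divide_distrib[symmetric]) simp
      qed
      show ?thesis unfolding 1 2 add_diff_eq 3 ..
    qed
    from comb show ?thesis
      unfolding haar_def indicator_halves measure_halves identity[OF 3] .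
  qed
qed

end

text \<open>Each \<open>E j\<close> is the root of a binary tree of cells, obtained by cutting successively with
  \<open>A 0\<close>, \<open>A 1\<close>, \<open>\<dots>\<close>; a cell that is cut into two parts of positive measure gives a Haar function.
  The condition on \<open>A 0\<close> guarantees such a cut in every \<open>E j\<close>, hence infinitely many Haar functions.\<close>
locale haar_tree =
  fixes M :: "'a measure" and E A :: "nat \<Rightarrow> 'a set"
  assumes E_sets: "\<And>j. E j \<in> sets M"
    and E_disj: "disjoint_family E"
    and E_fin: "\<And>j. emeasure M (E j) < \<infinity>"
    and A_sets: "\<And>n. A n \<in> sets M"
    and first_split: "\<And>j. measure M (E j \<inter> A 0) > 0" "\<And>j. measure M (E j - A 0) > 0"
    and total: "L1_total M {indicat_real (A n \<inter> E j) | n j. True}"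
begin

text \<open>Cells are numbered as in a heap: the root has number 1, and the part of cell \<open>v\<close> outside and
  inside the cutting set gets number \<open>2 * v\<close> and \<open>2 * v + 1\<close>. Then \<open>node n x\<close> is the number of the
  cell of depth \<open>n\<close> around \<open>x\<close>. A number determines the depth and all ancestors, and numbers
  increase along every branch.\<close>
primrec node :: "nat \<Rightarrow> 'a \<Rightarrow> nat" where
  "node 0 x = 1"
| "node (Suc n) x = 2 * node n x + (if x \<in> A n then 1 else 0)"

definition cell :: "nat \<Rightarrow> nat \<Rightarrow> 'a set" where
  "cell j v = {x \<in> E j. \<exists>n. node n x = v}"

lemma node_bounds: "2 ^ n \<le> node n x" "node n x < 2 ^ Suc n"
  by (induction n) auto

lemma node_level:
  assumes "2 ^ m \<le> v" "v < 2 ^ Suc m" "node n x = v"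
  shows "n = m"
proof (rule ccontr)
  assume "n \<noteq> m"
  then consider "Suc n \<le> m" | "Suc m \<le> n" by linarith
  then show False
  proof cases
    case 1
    then have "(2::nat) ^ Suc n \<le> 2 ^ m" by (intro power_increasing) auto
    then show False using assms node_bounds(2)[of n x] by linarith
  next
    case 2
    then have "(2::nat) ^ Suc m \<le> 2 ^ n" by (intro power_increasing) auto
    then show False using assms node_bounds(1)[of n x] by linarith
  qed
qed

lemma node_level_eq: "node n x = node m y \<Longrightarrow> n = m"
  using node_level[OF node_bounds] .

lemma node_pos: "node n x \<noteq> 0"
  using node_bounds(1)[of n x] by (metis le_zero_eq power_not_zero zero_neq_numeral)

lemma node_less: "node n x < node (Suc n) x"
  using node_pos[of n x] by simp

lemma node_strict_mono: "strict_mono (\<lambda>n. node n x)"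
  by (rule strict_monoI_Suc) (rule node_less)

lemma node_ancestors: "node n x = node n y \<Longrightarrow> i \<le> n \<Longrightarrow> node i x = node i y"
proof (induction n)
  case (Suc n)
  have "node (Suc n) z div 2 = node n z" for z by simp
  with Suc.prems(1) have "node n x = node n y" by metis
  with Suc show ?case by (cases "i = Suc n") auto
qed simp

lemma node_parent:
  assumes "w \<ge> 2" "node m x = w"
  shows "\<exists>n. m = Suc n \<and> node n x = w div 2"
  using assms by (cases m) auto

lemma cell_subset: "cell j v \<subseteq> E j"
  by (auto simp: cell_def)

lemma cell_0: "cell j 0 = {}"
  using node_pos by (auto simp: cell_def)

lemma cell_1: "cell j 1 = E j"
  by (auto simp: cell_def intro: exI[of _ 0])

lemma cell_children:
  assumes "v \<ge> 1"
  shows "cell j v = cell j (2 * v + 1) \<union> cell j (2 * v)"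
proof (intro equalityI subsetI)
  fix x assume "x \<in> cell j v"
  then obtain n where n: "x \<in> E j" "node n x = v" by (auto simp: cell_def)
  then have "node (Suc n) x = 2 * v + 1 \<or> node (Suc n) x = 2 * v" by simp
  with n show "x \<in> cell j (2 * v + 1) \<union> cell j (2 * v)"
    unfolding cell_def by blast
next
  fix x assume "x \<in> cell j (2 * v + 1) \<union> cell j (2 * v)"
  then obtain m w where m: "x \<in> E j" "node m x = w" "w = 2 * v + 1 \<or> w = 2 * v"
    by (auto simp: cell_def)
  then obtain n where "node n x = w div 2" using node_parent[of w m x] assms by auto
  moreover have "w div 2 = v" using m(3) by auto
  ultimately show "x \<in> cell j v" using m(1) by (auto simp: cell_def)
qed

lemma cell_children_disjoint: "cell j (2 * v + 1) \<inter> cell j (2 * v) = {}"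
proof (cases "v = 0")
  case False
  have False if x: "node n x = 2 * v + 1" "node m x = 2 * v" for n m x
  proof -
    obtain n' where n': "n = Suc n'" "node n' x = v" using node_parent[OF _ x(1)] False by auto
    obtain m' where m': "m = Suc m'" "node m' x = v" using node_parent[OF _ x(2)] False by auto
    have "n' = m'" using n' m' node_level_eq[of n' x m' x] by simp
    then show False using n' m' x by simp
  qed
  then show ?thesis by (auto simp: cell_def)
qed (simp add: cell_0)

text \<open>If \<open>x\<close> lies in both cells, then \<open>u\<close> is an ancestor of \<open>v\<close>, or \<open>v\<close> itself, because numbers increase
  along the branch of \<open>x\<close>; and all points of a cell share the ancestors of this cell.\<close>
lemma cell_subset_or_disjoint:
  assumes "u \<le> v" "x \<in> cell j v" "y \<in> cell j v" "x \<in> cell j u"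
  shows "y \<in> cell j u"
proof -
  obtain n m i where n: "node n x = v" and m: "node m y = v" and i: "node i x = u" and y: "y \<in> E j"
    using assms by (auto simp: cell_def)
  have "n = m" using node_level_eq[of n x m y] n m by simp
  have "i \<le> n" using assms(1) n i strict_mono_less_eq[OF node_strict_mono[of x], of i n] by simp
  then have "node i y = u" using node_ancestors[of n x y i] n m i \<open>n = m\<close> by simp
  with y show ?thesis by (auto simp: cell_def)
qed

text \<open>Only the parent \<open>w div 2\<close> is assumed to come before \<open>v\<close>, as the Haar function of a cell is
  expressed by its children. If \<open>v\<close> meets \<open>w\<close>, it is a proper descendant of the parent of \<open>w\<close>, and
  so \<open>w \<le> v\<close>.\<close>
lemma cell_child_subset_or_disjoint:
  assumes "w div 2 < v" "w \<ge> 2" "x \<in> cell j v" "y \<in> cell j v" "x \<in> cell j w"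
  shows "y \<in> cell j w"
proof (rule cell_subset_or_disjoint[OF _ assms(3-5)])
  obtain n m where n: "node n x = v" and m: "node m x = w"
    using assms by (auto simp: cell_def)
  obtain i where i: "m = Suc i" "node i x = w div 2" using node_parent[OF assms(2) m] by blast
  have "i < n" using assms(1) n i strict_mono_less[OF node_strict_mono[of x], of i n] by simp
  then show "w \<le> v"
    using n m i strict_mono_less_eq[OF node_strict_mono[of x], of m n] by simp
qed

lemma node_measurable: "node n \<in> measurable M (count_space UNIV)"
proof (induction n)
  case (Suc n)
  note [measurable] = Suc.IH A_sets
  show ?case unfolding node.simps by measurable
qed simp

lemma cell_sets: "cell j v \<in> sets M"
proof -
  have eq: "cell j v = (\<Union>n. E j \<inter> (node n -` {v} \<inter> space M))"
    using sets.sets_into_space[OF E_sets[of j]] by (auto simp: cell_def)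
  have "E j \<inter> (node n -` {v} \<inter> space M) \<in> sets M" for n
    by (intro sets.Int E_sets measurable_sets[OF node_measurable]) simp
  then show ?thesis
    unfolding eq by (intro sets.countable_nat_UN) blast
qed

lemma cell_fin: "emeasure M (cell j v) < \<infinity>"
  using emeasure_mono[OF cell_subset E_sets, of j v] E_fin[of j] by (rule le_less_trans)

lemma E_pos: "measure M (E j) > 0"
proof -
  have "measure M (E j \<inter> A 0) \<le> measure M (E j)"
    using E_sets A_sets E_fin by (intro measure_mono_fmeasurable) (auto simp: fmeasurable_def)
  then show ?thesis using first_split(1)[of j] by linarith
qed

definition splits :: "nat \<Rightarrow> nat \<Rightarrow> bool" where
  "splits j v \<longleftrightarrow> measure M (cell j (2 * v + 1)) > 0 \<and> measure M (cell j (2 * v)) > 0"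

text \<open>The split of cell \<open>v\<close> of \<open>E j\<close> is encoded by \<open>prod_encode (j, v)\<close>, which increases with \<open>v\<close> for
  fixed \<open>j\<close>. Enumerating the codes in increasing order therefore lists the split of a cell after
  those of its ancestors.\<close>
definition split_codes :: "nat set" where
  "split_codes = {q. case prod_decode q of (j, v) \<Rightarrow> splits j v}"

definition J :: "nat \<Rightarrow> nat" where
  "J k = fst (prod_decode (enumerate split_codes k))"

definition V :: "nat \<Rightarrow> nat" where
  "V k = snd (prod_decode (enumerate split_codes k))"

definition h :: "nat \<Rightarrow> 'a \<Rightarrow> real" where
  "h k = haar M (cell (J k) (2 * V k + 1)) (cell (J k) (2 * V k))"

lemma splits_pos: "splits j v \<Longrightarrow> v \<ge> 1"
  by (cases "v = 0") (auto simp: splits_def cell_0)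

lemma splits_root: "splits j 1"
proof -
  have eq: "node (Suc 0) x = (if x \<in> A 0 then 3 else 2)" for x by simp
  have lev: "node n x = 2 \<or> node n x = 3 \<Longrightarrow> n = Suc 0" for n x
    using node_level[of "Suc 0" "node n x" n x] by auto
  have "cell j 3 = E j \<inter> A 0"
  proof (intro equalityI subsetI)
    fix x assume "x \<in> cell j 3"
    then obtain n where "x \<in> E j" "node n x = 3" by (auto simp: cell_def)
    then show "x \<in> E j \<inter> A 0" using lev[of n x] eq[of x] by (auto split: if_splits)
  next
    fix x assume "x \<in> E j \<inter> A 0"
    then show "x \<in> cell j 3" using eq[of x] by (auto simp: cell_def simp del: node.simps)
  qed
  moreover have "cell j 2 = E j - A 0"
  proof (intro equalityI subsetI)
    fix x assume "x \<in> cell j 2"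
    then obtain n where "x \<in> E j" "node n x = 2" by (auto simp: cell_def)
    then show "x \<in> E j - A 0" using lev[of n x] eq[of x] by (auto split: if_splits)
  next
    fix x assume "x \<in> E j - A 0"
    then show "x \<in> cell j 2" using eq[of x] by (auto simp: cell_def simp del: node.simps)
  qed
  ultimately show ?thesis using first_split by (simp add: splits_def)
qed

lemma infinite_split_codes: "infinite split_codes"
proof
  assume "finite split_codes"
  moreover have "range (\<lambda>j. prod_encode (j, 1)) \<subseteq> split_codes"
    using splits_root by (auto simp: split_codes_def)
  ultimately have "finite (range (\<lambda>j. prod_encode (j, 1::nat)))" by (rule rev_finite_subset)
  moreover have "inj (\<lambda>j. prod_encode (j, 1::nat))" by (auto intro!: injI simp: prod_encode_eq)
  ultimately show False by (simp add: finite_image_iff)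
qed

lemma splits_JV: "splits (J k) (V k)"
  using enumerate_in_set[OF infinite_split_codes, of k]
  by (simp add: split_codes_def J_def V_def case_prod_beta)

lemma splits_enumerated:
  assumes "splits j v"
  shows "\<exists>k. J k = j \<and> V k = v"
proof -
  have "prod_encode (j, v) \<in> split_codes" using assms by (simp add: split_codes_def)
  then obtain k where "enumerate split_codes k = prod_encode (j, v)"
    using enumerate_Ex[OF infinite_split_codes] by blast
  then show ?thesis by (intro exI[of _ k]) (simp add: J_def V_def)
qed

lemma prod_encode_mono: "v \<le> v' \<Longrightarrow> prod_encode (j, v) \<le> prod_encode (j, v')"
proof -
  assume "v \<le> v'"
  moreover have "triangle m \<le> triangle n" if "m \<le> n" for m n
    using that by (rule lift_Suc_mono_le[rotated]) simp
  ultimately show ?thesis by (simp add: prod_encode_def)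
qed

lemma V_less:
  assumes "i < k" "J i = J k"
  shows "V i < V k"
proof (rule ccontr)
  have code: "enumerate split_codes k = prod_encode (J k, V k)" for k
    by (simp add: J_def V_def)
  assume "\<not> V i < V k"
  then have "prod_encode (J k, V k) \<le> prod_encode (J i, V i)"
    using assms(2) by (simp add: prod_encode_mono)
  then show False
    using enumerate_mono[OF assms(1) infinite_split_codes] unfolding code by simp
qed

text \<open>Within one \<open>E j\<close> the earlier Haar function belongs to an ancestor or to a disjoint cell, and
  in different sets \<open>E j\<close> the supports are disjoint.\<close>
lemma h_const:
  assumes "i < k" "x \<in> cell (J k) (V k)" "y \<in> cell (J k) (V k)"
  shows "h i x = h i y"
proof (cases "J i = J k")
  case True
  have "x \<in> cell (J k) w \<longleftrightarrow> y \<in> cell (J k) w" if "w div 2 = V i" for w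
  proof -
    have "w \<ge> 2" using splits_pos[OF splits_JV, of i] that by auto
    then show ?thesis
      using V_less[OF assms(1) True] assms(2,3) that
      by (intro iffI; elim cell_child_subset_or_disjoint[rotated 4]) auto
  qed
  from this[of "2 * V i + 1"] this[of "2 * V i"] show ?thesis
    using True by (simp add: h_def haar_def indicator_def)
next
  case False
  have "z \<notin> cell (J i) w" if "z \<in> cell (J k) (V k)" for z w
    using that cell_subset False E_disj unfolding disjoint_family_on_def by blast
  then show ?thesis using assms(2,3) by (simp add: h_def haar_def)
qed

lemma h_supp: "x \<notin> cell (J k) (V k) \<Longrightarrow> h k x = 0"
  using cell_children[OF splits_pos[OF splits_JV], of "J k" k] by (auto simp: h_def haar_def)

lemmas cell_halves = cell_sets[of _ "2 * _ + 1"] cell_fin[of _ "2 * _ + 1"]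
  cell_sets[of _ "2 * _"] cell_fin[of _ "2 * _"] cell_children_disjoint

lemma perturbed_haar: "perturbed_haar M E J h"
proof
  show "h k \<in> L1 M" for k
    unfolding h_def by (rule haar_L1[OF cell_halves])
  show "L1_norm M (h k) = 1" for k
    unfolding h_def using splits_JV[of k] by (intro haar_norm[OF cell_halves]) (auto simp: splits_def)
  show mean: "(\<integral>x. h k x \<partial>M) = 0" for k
    unfolding h_def using splits_JV[of k] by (intro haar_mean[OF cell_halves]) (auto simp: splits_def)
  show "h k x = 0" if "x \<notin> E (J k)" for k x
    using that cell_subset by (intro h_supp) blast
  show "L1_norm M (\<lambda>x. \<Sum>k<m. a k * h k x) \<le> L1_norm M (\<lambda>x. \<Sum>k<N. a k * h k x)"
    if "m \<le> N" for a m N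
  proof (rule haar_system_monotone[where C = "\<lambda>k. cell (J k) (V k)"])
    show "h k \<in> L1 M" for k
      unfolding h_def by (rule haar_L1[OF cell_halves])
    show "h i x = h i y"
      if "i < k" "x \<in> cell (J k) (V k)" "y \<in> cell (J k) (V k)" for i k x y
      using that by (rule h_const)
  qed (fact h_supp mean that)+
qed (use E_sets E_disj E_fin E_pos in auto)

sublocale ph: perturbed_haar M E J h
  by (rule perturbed_haar)

text \<open>Induction along the tree: at the root the function vanishes, and every cut passes membership on
  to both children.\<close>
lemma centered_cell_in_closed_subspace:
  assumes W: "L1_closed_subspace M W" and hW: "\<And>k. h k \<in> W"
  shows "(\<lambda>x. indicat_real (cell j v) x - measure M (cell j v) * ph.e j x) \<in> W"
proof (induction v rule: less_induct)
  case (less v)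
  consider "v = 0" | "v = 1" | "v \<ge> 2" by linarith
  then show ?case
  proof cases
    case 1
    then show ?thesis using closed_subspace_zero[OF W] by (simp add: cell_0)
  next
    case 2
    have "(\<lambda>x. indicat_real (cell j v) x - measure M (cell j v) * ph.e j x) = (\<lambda>x. 0)"
      using 2 E_pos[of j] by (simp only: cell_1 ph.e_def) simp
    then show ?thesis using closed_subspace_zero[OF W] by simp
  next
    case 3
    define u where "u = v div 2"
    have u: "u < v" "u \<ge> 1" using 3 by (auto simp: u_def)
    have parent: "(\<lambda>x. indicat_real (cell j (2 * u + 1) \<union> cell j (2 * u)) x
        - measure M (cell j (2 * u + 1) \<union> cell j (2 * u)) * ph.e j x) \<in> W"
      using less[OF u(1)] cell_children[OF u(2), of j] by simp
    have haarW: "haar M (cell j (2 * u + 1)) (cell j (2 * u)) \<in> W"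
      if "measure M (cell j (2 * u + 1)) > 0" "measure M (cell j (2 * u)) > 0"
    proof -
      have "splits j u" using that by (simp add: splits_def)
      then obtain k where "J k = j" "V k = u" using splits_enumerated by blast
      then show ?thesis using hW[of k] by (simp add: h_def)
    qed
    have "v = 2 * u + 1 \<or> v = 2 * u" by (auto simp: u_def)
    then show ?thesis
    proof
      assume "v = 2 * u + 1"
      then show ?thesis
        using centered_half_in_closed_subspace[OF cell_halves W ph.e_L1 parent haarW] by simp
    next
      assume v: "v = 2 * u"
      have "haar M (cell j (2 * u)) (cell j (2 * u + 1)) \<in> W"
        if "measure M (cell j (2 * u)) > 0" "measure M (cell j (2 * u + 1)) > 0"
        unfolding haar_swap[of M "cell j (2 * u)"]
        by (rule closed_subspace_scale[OF W haarW[OF that(2,1)]])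
      note right = centered_half_in_closed_subspace[OF cell_sets cell_fin cell_sets cell_fin _ W ph.e_L1 _ this]
      have "cell j (2 * u) \<inter> cell j (2 * u + 1) = {}"
        using cell_children_disjoint[of j u] by blast
      moreover have "cell j (2 * u) \<union> cell j (2 * u + 1) = cell j (2 * u + 1) \<union> cell j (2 * u)"
        by (rule Un_commute)
      ultimately show ?thesis
        unfolding v by (intro right) (simp_all only: parent)
    qed
  qed
qed

text \<open>The absolute value of a Haar function is the average of the normalized indicators of its two
  halves, both of which agree with \<open>e (J k)\<close> modulo mean-zero combinations of cells.\<close>
lemma abs_h_in_closed_subspace:
  assumes W: "L1_closed_subspace M W" and hW: "\<And>k. h k \<in> W"
  shows "(\<lambda>x. \<bar>h k x\<bar> - ph.e (J k) x) \<in> W"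
proof -
  let ?L = "cell (J k) (2 * V k + 1)" and ?R = "cell (J k) (2 * V k)"
  let ?c = "\<lambda>B x. (1 / (2 * measure M B)) * (indicat_real B x - measure M B * ph.e (J k) x)"
  have "(\<lambda>x. ?c ?L x + ?c ?R x) \<in> W"
    by (intro closed_subspace_add[OF W] closed_subspace_scale[OF W]
        centered_cell_in_closed_subspace[OF W hW])
  moreover have "?c B x = indicat_real B x / (2 * measure M B) - ph.e (J k) x / 2"
    if "measure M B > 0" for B x
    using that by (simp add: field_simps)
  ultimately show ?thesis
    using splits_JV[of k] unfolding splits_def h_def abs_haar[OF cell_halves] by simp
qed

lemma A_E_cells: "A n \<inter> E j = (\<Union>v\<in>{2 ^ n..<2 ^ Suc n}. cell j (2 * v + 1))"
proof (intro equalityI subsetI)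
  fix x assume x: "x \<in> A n \<inter> E j"
  then have "x \<in> cell j (2 * node n x + 1)"
    by (auto simp: cell_def intro!: exI[of _ "Suc n"])
  then show "x \<in> (\<Union>v\<in>{2 ^ n..<2 ^ Suc n}. cell j (2 * v + 1))"
    using node_bounds[of n x] by fastforce
next
  fix x assume "x \<in> (\<Union>v\<in>{2 ^ n..<2 ^ Suc n}. cell j (2 * v + 1))"
  then obtain v m where v: "2 ^ n \<le> v" "v < 2 ^ Suc n" "x \<in> E j" "node m x = 2 * v + 1"
    by (auto simp: cell_def)
  have "m = Suc n" using node_level[of "Suc n" "2 * v + 1" m x] v by simp
  with v(4) have "x \<in> A n" by (auto split: if_splits) presburger
  with v(3) show "x \<in> A n \<inter> E j" by simp
qed

lemma cells_same_level_disjoint: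
  "disjoint_family_on (\<lambda>v. cell j (2 * v + 1)) {2 ^ n..<2 ^ Suc n}"
  unfolding disjoint_family_on_def
proof (intro ballI impI)
  fix u v :: nat assume uv: "u \<in> {2 ^ n..<2 ^ Suc n}" "v \<in> {2 ^ n..<2 ^ Suc n}" "u \<noteq> v"
  have "False" if x: "node m x = 2 * u + 1" "node l x = 2 * v + 1" for m l x
    using node_level[of "Suc n" "2 * u + 1" m x] node_level[of "Suc n" "2 * v + 1" l x] uv x by simp
  then show "cell j (2 * u + 1) \<inter> cell j (2 * v + 1) = {}" by (auto simp: cell_def)
qed

lemma total_b: "L1_total M (range ph.b)"
  unfolding L1_total_def
proof (intro allI impI, elim conjE)
  fix W assume W: "L1_closed_subspace M W" and bW: "range ph.b \<subseteq> W"
  note hW = ph.h_in_closed_subspace[OF W bW]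
  have eW: "ph.e j \<in> W" for j
    by (rule ph.e_in_closed_subspace[OF W bW abs_h_in_closed_subspace[OF W hW]])
  have cellW: "indicat_real (cell j v) \<in> W" for j v
    using closed_subspace_add[OF W centered_cell_in_closed_subspace[OF W hW, of j v]
        closed_subspace_scale[OF W eW, of "measure M (cell j v)" j]] by simp
  have "indicat_real (A n \<inter> E j) \<in> W" for n j
  proof -
    have "indicat_real (A n \<inter> E j) x = (\<Sum>v\<in>{2 ^ n..<2 ^ Suc n}. indicat_real (cell j (2 * v + 1)) x)" for x
      unfolding A_E_cells by (rule indicator_UN_disjoint[OF _ cells_same_level_disjoint]) simp
    then have "indicat_real (A n \<inter> E j) = (\<lambda>x. \<Sum>v\<in>{2 ^ n..<2 ^ Suc n}. indicat_real (cell j (2 * v + 1)) x)"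
      by (rule ext)
    then show ?thesis using closed_subspace_sum[OF W cellW] by simp
  qed
  then show "W = L1 M"
    using total W unfolding L1_total_def by blast
qed

lemma nonneg_schauder_basis: "\<exists>b. L1_schauder_basis M b \<and> (\<forall>n. nonneg_ae M (b n))"
  using ph.schauder_basis_b[OF total_b] ph.b_nonneg
  by (intro exI[of _ ph.b]) (auto simp: nonneg_ae_def)

end

section \<open>Total sequences of indicators\<close>

lemma disjoint_family_unique_index: "disjoint_family B \<Longrightarrow> x \<in> B i \<Longrightarrow> x \<in> B j \<Longrightarrow> i = j"
  by (auto simp: disjoint_family_on_def)

text \<open>The roots \<open>E j\<close> have to cover all sets \<open>A n\<close> and must each admit a first cut. So every \<open>E j\<close> gets
  two of the sets \<open>F i\<close>, which the additional cutting set \<open>B 0\<close> separates, and in addition the part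
  of \<open>A j\<close> that lies outside all \<open>F i\<close> and all earlier \<open>A i\<close>, which may be null.\<close>
lemma nonneg_schauder_basis_if_total:
  fixes A F :: "nat \<Rightarrow> 'a set"
  assumes A: "\<And>n. A n \<in> sets M" "\<And>n. emeasure M (A n) < \<infinity>"
    and total: "L1_total M (range (\<lambda>n. indicat_real (A n)))"
    and F: "\<And>i. F i \<in> sets M" "\<And>i. emeasure M (F i) < \<infinity>" "\<And>i. measure M (F i) > 0"
      "disjoint_family F"
  shows "\<exists>b. L1_schauder_basis M b \<and> (\<forall>n. nonneg_ae M (b n))"
proof -
  define D where "D j = disjointed A j - (\<Union>i. F i)" for j
  define E where "E j = F (2 * j) \<union> F (2 * j + 1) \<union> D j" for j
  define B where "B = case_nat (\<Union>i. F (2 * i)) A"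
  note F_eq = disjoint_family_unique_index[OF F(4)]
  have D_eq: "i = j" if "x \<in> D i" "x \<in> D j" for x i j
    using that disjoint_family_unique_index[OF disjoint_family_disjointed[of A]] by (auto simp: D_def)
  have DF: "x \<notin> F i" if "x \<in> D j" for x i j
    using that by (auto simp: D_def)
  have D_sets: "D j \<in> sets M" for j
  proof -
    have "range (disjointed A) \<subseteq> sets M" using A(1) by (intro sets.range_disjointed_sets) auto
    then show ?thesis unfolding D_def using F(1) by (intro sets.Diff sets.countable_UN) auto
  qed
  have D_fin: "emeasure M (D j) < \<infinity>" for j
  proof -
    have "D j \<subseteq> A j" using disjointed_subset[of A j] by (auto simp: D_def)
    then show ?thesis using A by (meson emeasure_mono le_less_trans)
  qed
  have E_sets: "E j \<in> sets M" for j
    using F D_sets by (auto simp: E_def)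
  have E_disj: "disjoint_family E"
    unfolding disjoint_family_on_def
  proof (intro ballI impI)
    fix i j :: nat assume "i \<noteq> j"
    have False if x: "x \<in> E i" "x \<in> E j" for x
    proof (cases "\<exists>k. x \<in> F k")
      case True
      then obtain k where k: "x \<in> F k" ..
      have "k = 2 * i \<or> k = 2 * i + 1" 
        using x(1) k DF[of x i k] F_eq[of x k "2 * i"] F_eq[of x k "2 * i + 1"] unfolding E_def by blast
      moreover have "k = 2 * j \<or> k = 2 * j + 1" 
        using x(2) k DF[of x j k] F_eq[of x k "2 * j"] F_eq[of x k "2 * j + 1"] unfolding E_def by blast
      ultimately show False using \<open>i \<noteq> j\<close> by presburger
    next
      case False
      then show False using x D_eq[of x i j] \<open>i \<noteq> j\<close> by (auto simp: E_def)
    qed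
    then show "E i \<inter> E j = {}" by blast
  qed
  have E_fin: "emeasure M (E j) < \<infinity>" for j
  proof -
    have "E j \<in> fmeasurable M"
      unfolding E_def using F D_sets D_fin by (intro fmeasurable.Un fmeasurableI) auto
    then show ?thesis by (simp add: fmeasurable_def)
  qed
  have B_sets: "B n \<in> sets M" for n
    using A F(1) by (cases n) (auto simp: B_def)
  have odd_notin: "x \<notin> B 0" if "x \<in> F (2 * j + 1)" for x j
  proof
    assume "x \<in> B 0"
    then obtain i where "x \<in> F (2 * i)" by (auto simp: B_def)
    with F_eq[OF that] have "2 * j + 1 = 2 * i" by blast
    then show False by presburger
  qed
  have "D j \<inter> B 0 = {}" for j using DF by (auto simp: B_def)
  moreover have "F (2 * j + 1) \<inter> B 0 = {}" for j using odd_notin by blast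
  moreover have "F (2 * j) \<subseteq> B 0" for j by (auto simp: B_def)
  ultimately have "E j \<inter> B 0 = F (2 * j)" for j
    unfolding E_def by blast
  then have split1: "measure M (E j \<inter> B 0) > 0" for j
    using F(3) by simp
  have split2: "measure M (E j - B 0) > 0" for j
  proof -
    have "E j - B 0 \<in> fmeasurable M"
      using E_sets B_sets le_less_trans[OF emeasure_mono[of "E j - B 0" "E j" M] E_fin]
      by (intro fmeasurableI) blast+
    moreover have "F (2 * j + 1) \<subseteq> E j - B 0"
      using odd_notin unfolding E_def by blast
    ultimately have "measure M (F (2 * j + 1)) \<le> measure M (E j - B 0)"
      using F(1) by (intro measure_mono_fmeasurable)
    then show ?thesis using F(3)[of "2 * j + 1"] by linarith
  qed
  have tot: "L1_total M {indicat_real (B n \<inter> E j) | n j. True}"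
    unfolding L1_total_def
  proof (intro allI impI, elim conjE)
    fix W assume W: "L1_closed_subspace M W" and sub: "{indicat_real (B n \<inter> E j) | n j. True} \<subseteq> W"
    have "indicat_real (A n) \<in> W" for n
    proof -
      have "x \<in> (\<Union>j. A n \<inter> E j)" if x: "x \<in> A n" for x
      proof (cases "\<exists>k. x \<in> F k")
        case True
        then obtain k where "x \<in> F k" ..
        then have "x \<in> E (k div 2)"
          unfolding E_def by (cases "even k") (auto elim: evenE oddE)
        with x show ?thesis by blast
      next
        case False
        have "x \<in> (\<Union>j. disjointed A j)" using x by (auto simp: UN_disjointed_eq)
        with False x show ?thesis by (auto simp: E_def D_def)
      qed
      then have A_eq: "A n = (\<Union>j. A n \<inter> E j)" by blast
      have "indicat_real (\<Union>j. A n \<inter> E j) \<in> W"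
      proof (rule closed_subspace_indicator_UN[OF W])
        show "A n \<inter> E j \<in> sets M" for j using A E_sets by blast
        show "disjoint_family (\<lambda>j. A n \<inter> E j)"
          using E_disj by (auto simp: disjoint_family_on_def)
        show "emeasure M (\<Union>j. A n \<inter> E j) < \<infinity>" using A(2)[of n] A_eq by simp
        have "indicat_real (B (Suc n) \<inter> E j) \<in> W" for j
        proof (rule subsetD[OF sub], intro CollectI)
          show "\<exists>m i. indicat_real (B (Suc n) \<inter> E j) = indicat_real (B m \<inter> E i) \<and> True"
            by (rule exI[of _ "Suc n"], rule exI[of _ j]) simp
        qed
        then show "indicat_real (A n \<inter> E j) \<in> W" for j by (simp add: B_def)
      qed
      then show ?thesis using A_eq by simp
    qed
    then show "W = L1 M"
      using total W unfolding L1_total_def by blast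
  qed
  interpret haar_tree M E B
    by unfold_locales (fact E_sets E_disj E_fin B_sets split1 split2 tot)+
  show ?thesis by (rule nonneg_schauder_basis)
qed

text \<open>An integrable function is the limit of a sequence of integrable simple functions; the level sets
  of these for nonzero values are countably many and have finite measure.\<close>
lemma integrable_generated_by_indicators:
  assumes f: "f \<in> L1 M"
  shows "\<exists>G. countable G \<and> G \<subseteq> {B \<in> sets M. emeasure M B < \<infinity>} \<and>
    (\<forall>W. L1_closed_subspace M W \<and> indicat_real ` G \<subseteq> W \<longrightarrow> f \<in> W)"
proof -
  obtain c where "has_bochner_integral M f c"
    using f by (auto simp: L1_def integrable.simps)
  then obtain s where fm: "f \<in> borel_measurable M"
    and s: "\<And>i. Bochner_Integration.simple_bochner_integrable M (s i)"
    and lim: "(\<lambda>i. \<integral>\<^sup>+x. norm (f x - s i x) \<partial>M) \<longlonglongrightarrow> 0"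
    by (cases rule: has_bochner_integral.cases) blast
  have s_simple: "simple_function M (s i)" and s_fin: "emeasure M {y\<in>space M. s i y \<noteq> 0} \<noteq> \<infinity>" for i
    using s[of i] by (auto elim: Bochner_Integration.simple_bochner_integrable.cases)
  have s_L1: "s i \<in> L1 M" for i
    using has_bochner_integral_simple_bochner_integrable[OF s] by (auto simp: L1_def integrable.simps)
  have "L1_norm M (\<lambda>x. f x - s i x) = enn2real (\<integral>\<^sup>+x. norm (f x - s i x) \<partial>M)" for i
    unfolding L1_norm_def using fm L1_integrable[OF s_L1, of i]
    by (subst integral_eq_nn_integral) auto
  then have lim0: "(\<lambda>i. L1_norm M (\<lambda>x. f x - s i x)) \<longlonglongrightarrow> 0"
    using tendsto_enn2real[of _ 0, OF lim[unfolded ennreal_0[symmetric]]] by simp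
  define level where "level i y = {x \<in> space M. s i x = y}" for i y
  define G where "G = (\<Union>i. level i ` (s i ` space M - {0}))"
  have level_sets: "level i y \<in> sets M" for i y
    using simple_functionD(2)[OF s_simple, of i "{y}"] by (simp add: level_def vimage_def Int_def conj_commute)
  have level_fin: "emeasure M (level i y) < \<infinity>" if "y \<noteq> 0" for i y
  proof -
    have "{y\<in>space M. s i y \<noteq> 0} \<in> sets M"
      using s_simple[of i] by (auto intro: borel_measurable_simple_function)
    then have "emeasure M (level i y) \<le> emeasure M {y\<in>space M. s i y \<noteq> 0}"
      using that by (intro emeasure_mono) (auto simp: level_def)
    then show ?thesis using s_fin[of i] by (auto simp: less_top[symmetric] top_unique)
  qed
  have fin: "finite (s i ` space M)" for i
    using s_simple by (rule simple_functionD(1))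
  have "f \<in> W" if W: "L1_closed_subspace M W" and sub: "indicat_real ` G \<subseteq> W" for W
  proof (rule closed_subspace_limit[OF W f _ lim0])
    fix i
    have "indicat_real (level i y) \<in> W" if "y \<in> s i ` space M - {0}" for y
      using that sub unfolding G_def by blast
    then have 1: "(\<lambda>x. \<Sum>y\<in>s i ` space M - {0}. y * indicat_real (level i y) x) \<in> W"
      by (intro closed_subspace_sum[OF W] closed_subspace_scale[OF W])
    have 2: "s i x = (\<Sum>y\<in>s i ` space M - {0}. y * indicat_real (level i y) x)"
      if "x \<in> space M" for x
    proof -
      have "(\<Sum>y\<in>s i ` space M - {0}. y * indicat_real (level i y) x)
          = (\<Sum>y\<in>s i ` space M - {0}. if y = s i x then s i x else 0)"
        using that by (intro sum.cong) (auto simp: level_def)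
      also have "\<dots> = s i x" using fin that by simp
      finally show ?thesis by simp
    qed
    show "s i \<in> W"
      by (rule closed_subspace_AE[OF W s_L1 1 AE_I2[OF 2]])
  qed
  moreover have "countable G"
  proof -
    have "countable (level i ` (s i ` space M - {0}))" for i
      using fin by (intro countable_finite) simp
    then show ?thesis unfolding G_def by (intro countable_UN) simp_all
  qed
  moreover have "G \<subseteq> {B \<in> sets M. emeasure M B < \<infinity>}"
    using level_sets level_fin by (auto simp: G_def)
  ultimately show ?thesis by blast
qed

lemma L1_separable_total_sequence:
  assumes "L1_separable M"
  shows "\<exists>A::nat \<Rightarrow> 'a set. (\<forall>n. A n \<in> sets M \<and> emeasure M (A n) < \<infinity>) \<and>
    L1_total M (range (\<lambda>n. indicat_real (A n)))"
proof -
  obtain D where D: "countable D" "D \<subseteq> L1 M"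
    and dense: "\<And>f \<epsilon>. f \<in> L1 M \<Longrightarrow> \<epsilon> > 0 \<Longrightarrow> \<exists>g\<in>D. L1_norm M (\<lambda>x. f x - g x) < \<epsilon>"
    using assms unfolding L1_separable_def by blast
  have "\<forall>f\<in>D. \<exists>G. countable G \<and> G \<subseteq> {B \<in> sets M. emeasure M B < \<infinity>} \<and>
    (\<forall>W. L1_closed_subspace M W \<and> indicat_real ` G \<subseteq> W \<longrightarrow> f \<in> W)"
  proof
    fix f assume "f \<in> D"
    with D(2) show "\<exists>G. countable G \<and> G \<subseteq> {B \<in> sets M. emeasure M B < \<infinity>} \<and>
        (\<forall>W. L1_closed_subspace M W \<and> indicat_real ` G \<subseteq> W \<longrightarrow> f \<in> W)"
      by (intro integrable_generated_by_indicators) blast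
  qed
  from bchoice[OF this] obtain G where G: "\<forall>f\<in>D. countable (G f) \<and>
      G f \<subseteq> {B \<in> sets M. emeasure M B < \<infinity>} \<and>
      (\<forall>W. L1_closed_subspace M W \<and> indicat_real ` G f \<subseteq> W \<longrightarrow> f \<in> W)" ..
  define H where "H = insert {} (\<Union>f\<in>D. G f)"
  have H: "countable H" "H \<noteq> {}" using D(1) G by (auto simp: H_def)
  define A where "A = from_nat_into H"
  have rA: "range A = H" unfolding A_def using H by (intro range_from_nat_into)
  have "\<forall>B\<in>H. B \<in> sets M \<and> emeasure M B < \<infinity>" using G by (auto simp: H_def)
  then have "\<forall>n. A n \<in> sets M \<and> emeasure M (A n) < \<infinity>" using rA by blast
  moreover have "L1_total M (range (\<lambda>n. indicat_real (A n)))"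
    unfolding L1_total_def
  proof (intro allI impI, elim conjE)
    fix W assume W: "L1_closed_subspace M W" and sub: "range (\<lambda>n. indicat_real (A n)) \<subseteq> W"
    have "range (\<lambda>n. indicat_real (A n)) = indicat_real ` H"
      unfolding rA[symmetric] by (simp add: image_image)
    then have "indicat_real ` G f \<subseteq> W" if "f \<in> D" for f
      using that sub by (auto simp: H_def)
    then have "D \<subseteq> W" using G W by blast
    then have "f \<in> W" if "f \<in> L1 M" for f
      using closed_subspace_closed[OF W that] dense[OF that] by blast
    then show "W = L1 M" using closed_subspace_L1[OF W] by blast
  qed
  ultimately show ?thesis by blast
qed

lemma closed_subspace_all_indicators:
  assumes W: "L1_closed_subspace M W"
    and ind: "\<And>B. B \<in> sets M \<Longrightarrow> emeasure M B < \<infinity> \<Longrightarrow> indicat_real B \<in> W"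
  shows "W = L1 M"
proof (intro equalityI subsetI)
  fix f assume "f \<in> L1 M"
  from integrable_generated_by_indicators[OF this] W ind show "f \<in> W" by blast
qed (rule closed_subspace_L1[OF W])

section \<open>The half-line\<close>

lemma sets_half_line: "B \<in> sets (lebesgue_on {0<..}) \<longleftrightarrow> B \<in> sets lebesgue \<and> B \<subseteq> {0<..}" for B :: "real set"
  using sets_restrict_space_iff[of "{0<..}" lebesgue B] by (simp add: conj_commute)

lemma emeasure_half_line:
  "B \<in> sets lebesgue \<Longrightarrow> B \<subseteq> {0<..} \<Longrightarrow> emeasure (lebesgue_on {0<..}) B = emeasure lebesgue B"
  for B :: "real set"
  by (rule emeasure_restrict_space) simp_all

lemma Ioc_half_line:
  fixes a b :: real
  assumes "0 \<le> a" "a \<le> b"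
  shows "{a<..b} \<in> sets (lebesgue_on {0<..})" "emeasure (lebesgue_on {0<..}) {a<..b} = ennreal (b - a)"
    "measure (lebesgue_on {0<..}) {a<..b} = b - a"
proof -
  have sub: "{a<..b} \<subseteq> {0<..}" using assms by auto
  show "{a<..b} \<in> sets (lebesgue_on {0<..})" using sub by (simp add: sets_half_line)
  show "emeasure (lebesgue_on {0<..}) {a<..b} = ennreal (b - a)"
    using sub assms by (subst emeasure_half_line) auto
  then show "measure (lebesgue_on {0<..}) {a<..b} = b - a"
    using assms by (simp add: measure_def)
qed

text \<open>A closed subspace containing the indicators of \<open>(0, q]\<close> for rational \<open>q\<close> contains those for
  real endpoints by approximation, those of all bounded Borel sets by Dynkin's argument for the
  intersection-stable generator \<open>{..a}\<close>, those of bounded Lebesgue sets as these are Borel up to null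
  sets, and then those of all sets of finite measure by cutting at the integers. The maximum with
  zero keeps the endpoints in order at the negative rationals.\<close>
lemma half_line_total:
  "L1_total (lebesgue_on {0<..} :: real measure) (range (\<lambda>n. indicat_real {0<..max 0 (from_nat_into \<rat> n)}))"
    (is "L1_total ?M _")
  unfolding L1_total_def
proof (intro allI impI, elim conjE)
  fix W assume W: "L1_closed_subspace ?M W"
    and sub: "range (\<lambda>n. indicat_real {0<..max 0 (from_nat_into \<rat> n)}) \<subseteq> W"
  have rat: "indicat_real {0<..q} \<in> W" if q: "q \<in> \<rat>" "q \<ge> 0" for q :: real
  proof -
    obtain n where "from_nat_into \<rat> n = q"
      using from_nat_into_surj[OF countable_rat q(1)] by blast
    moreover have "indicat_real {0<..max 0 (from_nat_into \<rat> n)} \<in> W"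
      using sub by blast
    ultimately show ?thesis using q(2) by (simp add: max_absorb2)
  qed
  have Ioc: "indicat_real {0<..a} \<in> W" for a :: real
  proof (cases "a \<ge> 0")
    case True
    show ?thesis
    proof (rule closed_subspace_closed[OF W])
      show "indicat_real {0<..a} \<in> L1 ?M"
        using Ioc_half_line[of 0 a] True by (intro L1_indicator) auto
      fix \<epsilon> :: real assume "\<epsilon> > 0"
      then obtain q where q: "q \<in> \<rat>" "a < q" "q < a + \<epsilon>"
        using Rats_dense_in_real[of a "a + \<epsilon>"] by auto
      have "L1_norm ?M (\<lambda>x. indicat_real {0<..a} x - indicat_real {0<..q} x) = (\<integral>x. indicat_real {a<..q} x \<partial>?M)"
        unfolding L1_norm_def using q True
        by (intro Bochner_Integration.integral_cong) (auto split: split_indicator)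
      also have "\<dots> = q - a"
        using integral_indicator_eq_measure[OF Ioc_half_line(1)[of a q]] Ioc_half_line(3)[of a q] True q by simp
      finally show "\<exists>g\<in>W. L1_norm ?M (\<lambda>x. indicat_real {0<..a} x - g x) < \<epsilon>"
        using q True by (intro bexI[OF _ rat[of q]]) auto
    qed
  next
    case False
    then have "indicat_real {0<..a} = (\<lambda>x. 0)" by (auto simp: fun_eq_iff split: split_indicator)
    then show ?thesis using closed_subspace_zero[OF W] by simp
  qed
  have bounded_fin: "emeasure ?M (B \<inter> {0<..m}) < \<infinity>" if "B \<inter> {0<..m} \<in> sets ?M" "m \<ge> 0" for B m
  proof -
    have "emeasure ?M (B \<inter> {0<..m}) \<le> emeasure ?M {0<..m}"
      using Ioc_half_line(1)[of 0 m] that(2) by (intro emeasure_mono) auto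
    also have "\<dots> < \<infinity>" using Ioc_half_line(2)[of 0 m] that(2) by simp
    finally show ?thesis .
  qed
  have Borel: "indicat_real (B \<inter> {0<..m}) \<in> W" if "B \<in> sets borel" "m \<ge> 0" for B and m :: real
  proof -
    have borel_gen: "sets (borel :: real measure) = sigma_sets UNIV (range atMost)"
      by (subst borel_eq_atMost) (simp add: sets_measure_of)
    have bs: "B \<inter> {0<..m} \<in> sets ?M" if "B \<in> sets borel" for B
      using that by (auto simp: sets_half_line)
    have "Int_stable (range (atMost :: real \<Rightarrow> _))"
      by (auto simp: Int_stable_def)
    moreover have "range atMost \<subseteq> Pow (UNIV :: real set)" by simp
    moreover have "B \<in> sigma_sets UNIV (range atMost)" using that borel_gen by simp
    ultimately show ?thesis
    proof (induction rule: sigma_sets_induct_disjoint)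
      case (basic B)
      then obtain a where "B = {..a}" by blast
      then have "B \<inter> {0<..m} = {0<..min a m}" by auto
      then show ?case using Ioc by simp
    next
      case empty
      then show ?case using closed_subspace_zero[OF W] by simp
    next
      case (compl B)
      have "indicat_real ((UNIV - B) \<inter> {0<..m}) = (\<lambda>x. indicat_real {0<..m} x - indicat_real (B \<inter> {0<..m}) x)"
        by (auto simp: fun_eq_iff split: split_indicator)
      then show ?case using closed_subspace_diff[OF W Ioc compl.IH] by simp
    next
      case (union B)
      have Bb: "B i \<in> sets borel" for i using union(2) borel_gen by auto
      have eq: "(\<Union>i. B i) \<inter> {0<..m} = (\<Union>i. B i \<inter> {0<..m})" by blast
      show ?case
        unfolding eq
      proof (rule closed_subspace_indicator_UN[OF W bs[OF Bb]])
        show "disjoint_family (\<lambda>i. B i \<inter> {0<..m})"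
          using union(1) by (auto simp: disjoint_family_on_def)
        show "emeasure ?M (\<Union>i. B i \<inter> {0<..m}) < \<infinity>"
          unfolding eq[symmetric] using bs[of "\<Union>i. B i"] Bb \<open>m \<ge> 0\<close> by (intro bounded_fin) auto
      qed (use union in auto)
    qed
  qed
  have Leb: "indicat_real (B \<inter> {0<..m}) \<in> W" if B: "B \<in> sets ?M" and "m \<ge> 0" for B and m :: real
  proof -
    have "B \<in> sets lebesgue" using B by (simp add: sets_half_line)
    then obtain S N N' where S: "B = S \<union> N" "N \<subseteq> N'" "N' \<in> null_sets lborel" "S \<in> sets lborel"
      by (rule sets_completionE)
    have "AE x in lebesgue. x \<notin> N'"
      using S(3) by (intro AE_not_in null_sets_completionI)
    then have "AE x in ?M. x \<notin> N'"
      by (subst AE_restrict_space_iff) auto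
    then have ae: "AE x in ?M. indicat_real (B \<inter> {0<..m}) x = indicat_real (S \<inter> {0<..m}) x"
      by eventually_elim (use S in \<open>auto split: split_indicator\<close>)
    have "B \<inter> {0<..m} \<in> sets ?M" using B Ioc_half_line(1)[of 0 m] \<open>m \<ge> 0\<close> by blast
    then have "indicat_real (B \<inter> {0<..m}) \<in> L1 ?M"
      using bounded_fin \<open>m \<ge> 0\<close> by (intro L1_indicator)
    then show ?thesis
      using closed_subspace_AE[OF W _ Borel ae] S(4) \<open>m \<ge> 0\<close> by simp
  qed
  show "W = L1 ?M"
  proof (rule closed_subspace_all_indicators[OF W])
    fix B assume B: "B \<in> sets ?M" "emeasure ?M B < \<infinity>"
    have "x \<in> (\<Union>m::nat. B \<inter> {real m<..real m + 1})" if "x \<in> B" for x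
    proof -
      have "x > 0" using that B(1) by (auto simp: sets_half_line)
      then have "x \<in> {real (nat (\<lceil>x\<rceil> - 1))<..real (nat (\<lceil>x\<rceil> - 1)) + 1}"
        by (simp add: of_nat_nat) linarith
      with that show ?thesis by blast
    qed
    then have B_eq: "B = (\<Union>m::nat. B \<inter> {real m<..real m + 1})" by blast
    have "indicat_real (\<Union>m::nat. B \<inter> {real m<..real m + 1}) \<in> W"
    proof (rule closed_subspace_indicator_UN[OF W])
      show "B \<inter> {real m<..real m + 1} \<in> sets ?M" for m
        using B(1) Ioc_half_line(1)[of "real m" "real m + 1"] by auto
      show "disjoint_family (\<lambda>m. B \<inter> {real m<..real m + 1})"
        by (auto simp: disjoint_family_on_def)
      show "emeasure ?M (\<Union>m. B \<inter> {real m<..real m + 1}) < \<infinity>"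
        using B(2) B_eq by simp
      have "indicat_real (B \<inter> {real m<..real m + 1})
          = (\<lambda>x. indicat_real (B \<inter> {0<..real m + 1}) x - indicat_real (B \<inter> {0<..real m}) x)" for m
        by (auto simp: fun_eq_iff split: split_indicator)
      then show "indicat_real (B \<inter> {real m<..real m + 1}) \<in> W" for m
        using closed_subspace_diff[OF W Leb[OF B(1)] Leb[OF B(1)]] by simp
    qed
    then show "indicat_real B \<in> W" using B_eq by simp
  qed
qed

lemma half_line_nonneg_schauder_basis:
  "\<exists>b. L1_schauder_basis (lebesgue_on {0<..} :: real measure) b \<and>
    (\<forall>n. nonneg_ae (lebesgue_on {0<..}) (b n))"
proof (rule nonneg_schauder_basis_if_total[OF _ _ half_line_total])
  let ?F = "\<lambda>i::nat. {real i<..real i + 1}"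
  show "disjoint_family ?F" by (auto simp: disjoint_family_on_def)
qed (simp_all add: Ioc_half_line)

section \<open>Finitely many atoms or infinitely many disjoint sets\<close>

definition pos_sets :: "'a measure \<Rightarrow> 'a set \<Rightarrow> 'a set set" where
  "pos_sets M U = {B \<in> sets M. B \<subseteq> U \<and> emeasure M B < \<infinity> \<and> measure M B > 0}"

definition disjoint_pos_families :: "'a measure \<Rightarrow> 'a set \<Rightarrow> 'a set set set" where
  "disjoint_pos_families M U = {\<F>. finite \<F> \<and> disjoint \<F> \<and> \<F> \<subseteq> pos_sets M U}"

text \<open>The dichotomy between finite and infinite dimension is decided by the sizes of disjoint families
  of sets of positive measure. A uniform bound for these sizes passes to subsets and to finite
  unions, so the sets with this property form an ideal.\<close>
definition finitely_split :: "'a measure \<Rightarrow> 'a set \<Rightarrow> bool" where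
  "finitely_split M U \<longleftrightarrow> (\<exists>d. \<forall>\<F>\<in>disjoint_pos_families M U. card \<F> \<le> d)"

lemma pos_sets_nonempty: "B \<in> pos_sets M U \<Longrightarrow> B \<noteq> {}"
  by (auto simp: pos_sets_def)

lemma finitely_split_mono: "finitely_split M V \<Longrightarrow> U \<subseteq> V \<Longrightarrow> finitely_split M U"
proof -
  assume V: "finitely_split M V" and "U \<subseteq> V"
  then have "pos_sets M U \<subseteq> pos_sets M V" by (auto simp: pos_sets_def)
  then have "disjoint_pos_families M U \<subseteq> disjoint_pos_families M V"
    by (auto simp: disjoint_pos_families_def)
  with V show ?thesis unfolding finitely_split_def by (meson subsetD)
qed

text \<open>The traces on \<open>U\<close> of the members that meet \<open>U\<close> in positive measure again form a disjoint family.\<close>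
lemma card_traces_le:
  assumes \<F>: "\<F> \<in> disjoint_pos_families M V" and U: "U \<in> sets M"
    and d: "\<And>\<G>. \<G> \<in> disjoint_pos_families M U \<Longrightarrow> card \<G> \<le> d"
  shows "card {B \<in> \<F>. measure M (B \<inter> U) > 0} \<le> d"
proof -
  let ?\<H> = "{B \<in> \<F>. measure M (B \<inter> U) > 0}"
  have fin: "finite ?\<H>" and disj: "\<And>B C. B \<in> \<F> \<Longrightarrow> C \<in> \<F> \<Longrightarrow> B \<noteq> C \<Longrightarrow> B \<inter> C = {}"
    and pos: "\<And>B. B \<in> \<F> \<Longrightarrow> B \<in> sets M \<and> emeasure M B < \<infinity>"
    using \<F> by (auto simp: disjoint_pos_families_def pos_sets_def disjoint_def)
  have ne: "B \<inter> U \<noteq> {}" if "B \<in> ?\<H>" for B using that by auto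
  have inj: "inj_on (\<lambda>B. B \<inter> U) ?\<H>"
  proof (rule inj_onI)
    fix B C assume "B \<in> ?\<H>" "C \<in> ?\<H>" "B \<inter> U = C \<inter> U"
    then show "B = C" using disj[of B C] ne[of B] by blast
  qed
  have "(\<lambda>B. B \<inter> U) ` ?\<H> \<in> disjoint_pos_families M U"
    unfolding disjoint_pos_families_def
  proof (intro CollectI conjI)
    show "finite ((\<lambda>B. B \<inter> U) ` ?\<H>)" using fin by blast
    show "disjoint ((\<lambda>B. B \<inter> U) ` ?\<H>)"
      using disj by (auto simp: disjoint_def)
    have "emeasure M (B \<inter> U) < \<infinity>" if "B \<in> \<F>" for B
      using emeasure_mono[of "B \<inter> U" B M] pos[OF that] by (auto intro: le_less_trans)
    then show "(\<lambda>B. B \<inter> U) ` ?\<H> \<subseteq> pos_sets M U"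
      using pos U by (auto simp: pos_sets_def)
  qed
  from d[OF this] show ?thesis using card_image[OF inj] by simp
qed

lemma finitely_split_Un:
  assumes U: "U \<in> sets M" "finitely_split M U" and V: "V \<in> sets M" "finitely_split M V"
  shows "finitely_split M (U \<union> V)"
proof -
  obtain d where d: "\<And>\<G>. \<G> \<in> disjoint_pos_families M U \<Longrightarrow> card \<G> \<le> d"
    using U(2) by (auto simp: finitely_split_def)
  obtain d' where d': "\<And>\<G>. \<G> \<in> disjoint_pos_families M V \<Longrightarrow> card \<G> \<le> d'"
    using V(2) by (auto simp: finitely_split_def)
  have "card \<F> \<le> d + d'" if \<F>: "\<F> \<in> disjoint_pos_families M (U \<union> V)" for \<F>
  proof -
    let ?U = "{B \<in> \<F>. measure M (B \<inter> U) > 0}" and ?V = "{B \<in> \<F>. measure M (B \<inter> V) > 0}"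
    have fin: "finite \<F>" using \<F> by (simp add: disjoint_pos_families_def)
    have "\<F> \<subseteq> ?U \<union> ?V"
    proof
      fix B assume B: "B \<in> \<F>"
      then have B': "B \<in> sets M" "B \<subseteq> U \<union> V" "emeasure M B < \<infinity>" "measure M B > 0"
        using \<F> by (auto simp: disjoint_pos_families_def pos_sets_def)
      have "B = (B \<inter> U) \<union> (B \<inter> V)" using B'(2) by blast
      then have "measure M B \<le> measure M (B \<inter> U) + measure M (B \<inter> V)"
        using measure_Un_le[of "B \<inter> U" M "B \<inter> V"] B'(1) U(1) V(1) by auto
      with B'(4) have "measure M (B \<inter> U) > 0 \<or> measure M (B \<inter> V) > 0" by linarith
      with B show "B \<in> ?U \<union> ?V" by blast
    qed
    then have "card \<F> \<le> card (?U \<union> ?V)" using fin by (intro card_mono) auto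
    also have "\<dots> \<le> card ?U + card ?V" by (rule card_Un_le)
    also have "\<dots> \<le> d + d'"
      using card_traces_le[OF \<F> U(1) d] card_traces_le[OF \<F> V(1) d'] by (rule add_mono)
    finally show ?thesis .
  qed
  then show ?thesis unfolding finitely_split_def by blast
qed

text \<open>\<open>U\<close> contains two disjoint sets \<open>B\<close> and \<open>C\<close> of positive measure. Removing \<open>B\<close> works unless
  \<open>U - B\<close> is finitely split; but then \<open>B\<close> is not, as finite unions would make \<open>U\<close> finitely split, and
  \<open>C\<close> can be removed since \<open>U - C\<close> contains \<open>B\<close>.\<close>
lemma not_finitely_split_peel:
  assumes U: "U \<in> sets M" and big: "\<not> finitely_split M U"
  shows "\<exists>B\<in>pos_sets M U. \<not> finitely_split M (U - B)"
proof -
  obtain \<F> where \<F>: "\<F> \<in> disjoint_pos_families M U" "\<not> card \<F> \<le> Suc 0"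
    using big unfolding finitely_split_def by blast
  then have "finite \<F>" by (simp add: disjoint_pos_families_def)
  with \<F>(2) obtain B C where BC: "B \<in> \<F>" "C \<in> \<F>" "B \<noteq> C"
    by (auto simp: card_le_Suc0_iff_eq)
  have pos: "B \<in> pos_sets M U" "C \<in> pos_sets M U" "B \<inter> C = {}"
    using \<F>(1) BC by (auto simp: disjoint_pos_families_def disjoint_def)
  have sets: "B \<in> sets M" "B \<subseteq> U" using pos by (auto simp: pos_sets_def)
  show ?thesis
  proof (cases "finitely_split M (U - B)")
    case True
    have "\<not> finitely_split M (U - C)"
    proof
      assume "finitely_split M (U - C)"
      then have "finitely_split M B"
        using sets pos(3) by (elim finitely_split_mono) blast
      then have "finitely_split M (B \<union> (U - B))"
        using True U sets by (intro finitely_split_Un) auto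
      moreover have "B \<union> (U - B) = U" using sets by blast
      ultimately show False using big by simp
    qed
    then show ?thesis using pos(2) by blast
  qed (use pos in blast)
qed

lemma infinite_disjoint_positive_sequence:
  assumes "\<not> finitely_split M (space M)"
  shows "\<exists>F :: nat \<Rightarrow> 'a set. disjoint_family F \<and> (\<forall>i. F i \<in> pos_sets M (space M))"
proof -
  have "\<exists>U. \<forall>n. (U n \<in> sets M \<and> \<not> finitely_split M (U n)) \<and>
    (U (Suc n) \<subseteq> U n \<and> U n - U (Suc n) \<in> pos_sets M (space M))"
  proof (rule dependent_nat_choice[where P = "\<lambda>_ U. U \<in> sets M \<and> \<not> finitely_split M U"
        and Q = "\<lambda>_ U U'. U' \<subseteq> U \<and> U - U' \<in> pos_sets M (space M)"])
    show "\<exists>U. U \<in> sets M \<and> \<not> finitely_split M U"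
      using assms sets.top by (intro exI[of _ "space M"]) simp
  next
    fix U and n :: nat assume U: "U \<in> sets M \<and> \<not> finitely_split M U"
    then obtain B where B: "B \<in> pos_sets M U" "\<not> finitely_split M (U - B)"
      using not_finitely_split_peel[of U M] by auto
    have B': "U - (U - B) = B" "B \<in> sets M" "B \<in> pos_sets M (space M)"
      using B(1) U sets.sets_into_space[of U M] by (auto simp: pos_sets_def)
    then have "(U - B \<in> sets M \<and> \<not> finitely_split M (U - B)) \<and>
        (U - B \<subseteq> U \<and> U - (U - B) \<in> pos_sets M (space M))"
      using B(2) U by auto
    then show "\<exists>U'. (U' \<in> sets M \<and> \<not> finitely_split M U') \<and>
        (U' \<subseteq> U \<and> U - U' \<in> pos_sets M (space M))"
      by (rule exI[of _ "U - B"])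
  qed
  then obtain U :: "nat \<Rightarrow> 'a set" where U: "\<And>n. U (Suc n) \<subseteq> U n"
    "\<And>n. U n - U (Suc n) \<in> pos_sets M (space M)"
    by blast
  have mono: "U n \<subseteq> U m" if "m \<le> n" for m n
    using that U(1) by (rule lift_Suc_antimono_le[of U, rotated])
  have "(U m - U (Suc m)) \<inter> (U n - U (Suc n)) = {}" if "m < n" for m n
    using mono[of "Suc m" n] that by auto
  then have "disjoint_family (\<lambda>n. U n - U (Suc n))"
    unfolding disjoint_family_on_def by (metis Int_commute linorder_neqE_nat)
  then show ?thesis using U(2) by blast
qed

text \<open>The set where \<open>f\<close> exceeds its mean on the atom is null or full. In both cases the deviation from
  the mean has a constant sign almost everywhere, and its integral is zero.\<close>
lemma AE_eq_mean_on_atom: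
  assumes f: "f \<in> L1 M" and B: "B \<in> sets M" "emeasure M B < \<infinity>" "measure M B > 0"
    and atom: "\<And>C. C \<in> sets M \<Longrightarrow> C \<subseteq> B \<Longrightarrow> measure M C = 0 \<or> measure M (B - C) = 0"
  shows "AE x in M. x \<in> B \<longrightarrow> f x = (\<integral>x. indicat_real B x * f x \<partial>M) / measure M B"
proof -
  define c where "c = (\<integral>x. indicat_real B x * f x \<partial>M) / measure M B"
  define u where "u x = indicat_real B x * (f x - c)" for x
  have Bf: "integrable M (\<lambda>x. indicat_real B x * f x)"
    using integrable_mult_indicator[OF B(1) L1_integrable[OF f]] by simp
  have u_eq: "u = (\<lambda>x. indicat_real B x * f x - c * indicat_real B x)"
    by (auto simp: u_def fun_eq_iff algebra_simps)
  have u_int: "integrable M u"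
    unfolding u_eq using Bf B by (intro Bochner_Integration.integrable_diff integrable_mult_right) auto
  have u_zero: "(\<integral>x. u x \<partial>M) = 0"
  proof -
    have "(\<integral>x. u x \<partial>M) = (\<integral>x. indicat_real B x * f x \<partial>M) - c * measure M B"
      unfolding u_eq using Bf B integral_indicator_eq_measure[OF B(1)]
      by (subst Bochner_Integration.integral_diff) auto
    then show ?thesis using B(3) by (simp add: c_def)
  qed
  have null: "AE x in M. x \<notin> C" if "C \<in> sets M" "C \<subseteq> B" "measure M C = 0" for C
  proof -
    have "emeasure M C < \<infinity>" using emeasure_mono[OF that(2) B(1)] B(2) by (rule le_less_trans)
    with that show ?thesis by (intro AE_not_in_measure_zero)
  qed
  define P where "P = {x \<in> space M. x \<in> B \<and> f x > c}"
  have P: "P \<in> sets M" "P \<subseteq> B"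
  proof -
    have [measurable]: "f \<in> borel_measurable M" "B \<in> sets M" using f B(1) by (auto simp: L1_def)
    show "P \<in> sets M" unfolding P_def by measurable
  qed (auto simp: P_def)
  have "AE x in M. u x = 0"
    using atom[OF P]
  proof
    assume "measure M P = 0"
    then have "AE x in M. x \<notin> P" using null P by blast
    then have "AE x in M. 0 \<le> - u x"
      by eventually_elim (use sets.sets_into_space[OF B(1)] in \<open>auto simp: u_def P_def split: split_indicator\<close>)
    then have "AE x in M. - u x = 0"
      using integral_nonneg_eq_0_iff_AE[of M "\<lambda>x. - u x"] u_int u_zero by simp
    then show ?thesis by simp
  next
    assume "measure M (B - P) = 0"
    then have "AE x in M. x \<notin> B - P" using null[of "B - P"] P B(1) by blast
    then have "AE x in M. 0 \<le> u x"
      by eventually_elim (auto simp: u_def P_def split: split_indicator)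
    then show ?thesis
      using integral_nonneg_eq_0_iff_AE[of M u] u_int u_zero by simp
  qed
  then show ?thesis
    unfolding c_def[symmetric] by eventually_elim (auto simp: u_def)
qed

text \<open>The sets where \<open>\<bar>f\<bar> \<ge> 1 / (n + 1)\<close> have finite measure by Markov's inequality, so they are
  null outside \<open>U\<close>.\<close>
lemma AE_eq_0_outside:
  assumes f: "f \<in> L1 M" and U: "U \<in> sets M"
    and out: "\<And>C. C \<in> sets M \<Longrightarrow> C \<inter> U = {} \<Longrightarrow> emeasure M C < \<infinity> \<Longrightarrow> measure M C = 0"
  shows "AE x in M. x \<notin> U \<longrightarrow> f x = 0"
proof -
  define C where "C n = {x \<in> space M. \<bar>f x\<bar> \<ge> 1 / real (Suc n)} - U" for n
  have fm: "f \<in> borel_measurable M" using f by (auto simp: L1_def)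
  have C0: "{x \<in> space M. \<bar>f x\<bar> \<ge> 1 / real (Suc n)} \<in> sets M" for n
    using fm by measurable
  have "AE x in M. x \<notin> C n" for n
  proof -
    have "emeasure M (C n) \<le> emeasure M {x \<in> space M. \<bar>f x\<bar> \<ge> 1 / real (Suc n)}"
      unfolding C_def using C0 by (intro emeasure_mono) auto
    also have "\<dots> \<le> (1 / (1 / real (Suc n))) * (\<integral>x. \<bar>f x\<bar> \<partial>M)"
      using f by (intro integral_Markov_inequality) (auto simp: L1_def)
    also have "\<dots> < \<infinity>" by simp
    finally have fin: "emeasure M (C n) < \<infinity>" .
    have Cs: "C n \<in> sets M" unfolding C_def using C0 U by blast
    have "measure M (C n) = 0" using fin Cs by (intro out) (auto simp: C_def)
    then show ?thesis by (rule AE_not_in_measure_zero[OF Cs fin])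
  qed
  then have "AE x in M. \<forall>n. x \<notin> C n" by (simp add: AE_all_countable)
  moreover have "AE x in M. x \<in> space M" by (rule AE_space)
  ultimately show ?thesis
  proof eventually_elim
    case (elim x)
    show ?case
    proof (intro impI, rule ccontr)
      assume "x \<notin> U" "f x \<noteq> 0"
      then obtain n where "inverse (real (Suc n)) < \<bar>f x\<bar>"
        using reals_Archimedean[of "\<bar>f x\<bar>"] by auto
      with elim \<open>x \<notin> U\<close> show False by (auto simp: C_def inverse_eq_divide dest!: spec[of _ n])
    qed
  qed
qed

text \<open>Such a family is a disjoint family of sets of positive measure of maximal size: splitting a
  member into two parts of positive measure, or adding such a set outside, would enlarge it.\<close>
lemma finite_atomic_cover:
  assumes "finitely_split M (space M)"
  obtains \<F> where "finite \<F>" "disjoint \<F>" "\<F> \<subseteq> pos_sets M (space M)"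
    "\<And>B C. B \<in> \<F> \<Longrightarrow> C \<in> sets M \<Longrightarrow> C \<subseteq> B \<Longrightarrow> measure M C = 0 \<or> measure M (B - C) = 0"
    "\<And>C. C \<in> sets M \<Longrightarrow> C \<inter> \<Union>\<F> = {} \<Longrightarrow> emeasure M C < \<infinity> \<Longrightarrow> measure M C = 0"
proof -
  obtain d0 where d0: "\<And>\<F>. \<F> \<in> disjoint_pos_families M (space M) \<Longrightarrow> card \<F> \<le> d0"
    using assms by (auto simp: finitely_split_def)
  have "\<exists>\<F>. \<F> \<in> disjoint_pos_families M (space M) \<and>
      (\<forall>\<G>. \<G> \<in> disjoint_pos_families M (space M) \<longrightarrow> card \<G> \<le> card \<F>)"
  proof (rule ex_has_greatest_nat[where b = "Suc d0"])
    show "{} \<in> disjoint_pos_families M (space M)" by (simp add: disjoint_pos_families_def)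
  qed (use d0 in \<open>simp add: less_Suc_eq_le\<close>)
  then obtain \<F> where \<F>: "\<F> \<in> disjoint_pos_families M (space M)"
    and max: "\<And>\<G>. \<G> \<in> disjoint_pos_families M (space M) \<Longrightarrow> card \<G> \<le> card \<F>" by blast
  have fin: "finite \<F>" and disj: "disjoint \<F>" and pos: "\<F> \<subseteq> pos_sets M (space M)"
    using \<F> by (auto simp: disjoint_pos_families_def)
  have sub: "C \<in> pos_sets M (space M)"
    if "C \<in> sets M" "C \<subseteq> B" "measure M C \<noteq> 0" "B \<in> \<F>" for B C
  proof -
    have "emeasure M C \<le> emeasure M B" using that pos by (intro emeasure_mono) (auto simp: pos_sets_def)
    also have "\<dots> < \<infinity>" using that(4) pos by (auto simp: pos_sets_def)
    finally show ?thesis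
      using that sets.sets_into_space[OF that(1)] measure_nonneg[of M C] by (auto simp: pos_sets_def less_le)
  qed
  have atom: "measure M C = 0 \<or> measure M (B - C) = 0"
    if B: "B \<in> \<F>" and C: "C \<in> sets M" "C \<subseteq> B" for B C
  proof (rule ccontr)
    assume ne: "\<not> ?thesis"
    have BC: "C \<in> pos_sets M (space M)" "B - C \<in> pos_sets M (space M)"
      using sub[of C B] sub[of "B - C" B] B C ne pos by (auto simp: pos_sets_def)
    let ?\<G> = "insert C (insert (B - C) (\<F> - {B}))"
    have other: "X \<inter> B = {}" if "X \<in> \<F> - {B}" for X
      using that disj B by (auto simp: disjoint_def)
    have notin: "X \<notin> \<F> - {B}" if "X \<subseteq> B" "X \<noteq> {}" for X
      using other[of X] that by blast
    have neq: "C \<noteq> B - C" using pos_sets_nonempty[OF BC(1)] by blast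
    have "card ?\<G> = Suc (Suc (card (\<F> - {B})))"
      using notin[OF C(2) pos_sets_nonempty[OF BC(1)]] notin[OF Diff_subset pos_sets_nonempty[OF BC(2)]]
        neq fin by simp
    then have "card ?\<G> = Suc (card \<F>)"
      by (simp only: card_Suc_Diff1[OF fin B])
    moreover have "disjoint ?\<G>"
    proof -
      have "disjoint (\<F> - {B})" using disj by (rule pairwise_subset) blast
      moreover have sep: "disjnt X Y \<and> disjnt Y X" if "X \<subseteq> B" "Y \<in> \<F> - {B}" for X Y
        using other[OF that(2)] that(1) by (auto simp: disjnt_def)
      ultimately have "disjoint (insert (B - C) (\<F> - {B}))"
        using sep[OF Diff_subset] unfolding pairwise_insert by blast
      moreover have "disjnt C (B - C) \<and> disjnt (B - C) C" by (auto simp: disjnt_def)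
      ultimately show ?thesis
        using sep[OF C(2)] unfolding pairwise_insert by blast
    qed
    then have "?\<G> \<in> disjoint_pos_families M (space M)"
      using fin pos BC by (auto simp: disjoint_pos_families_def)
    ultimately show False using max[of ?\<G>] by simp
  qed
  have outside: "measure M C = 0"
    if C: "C \<in> sets M" "C \<inter> \<Union>\<F> = {}" "emeasure M C < \<infinity>" for C
  proof (rule ccontr)
    assume "measure M C \<noteq> 0"
    then have Cpos: "C \<in> pos_sets M (space M)"
      using C sets.sets_into_space[OF C(1)] measure_nonneg[of M C] by (auto simp: pos_sets_def less_le)
    have "C \<notin> \<F>" using C(2) pos_sets_nonempty[OF Cpos] by blast
    moreover have "disjnt C X \<and> disjnt X C" if "X \<in> \<F>" for X
      using C(2) that by (auto simp: disjnt_def)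
    then have "disjoint (insert C \<F>)"
      using disj unfolding pairwise_insert by blast
    then have "insert C \<F> \<in> disjoint_pos_families M (space M)"
      using fin pos Cpos by (auto simp: disjoint_pos_families_def)
    ultimately show False using max[of "insert C \<F>"] fin by simp
  qed
  show thesis by (rule that[OF fin disj pos atom outside])
qed

lemma finite_nonneg_basis:
  assumes "finitely_split M (space M)"
  shows "\<exists>d b. L1_finite_basis M d b \<and> (\<forall>n<d. nonneg_ae M (b n))"
proof (rule finite_atomic_cover[OF assms])
  fix \<F> assume fin: "finite \<F>" and disj: "disjoint \<F>" and pos: "\<F> \<subseteq> pos_sets M (space M)"
    and atom: "\<And>B C. B \<in> \<F> \<Longrightarrow> C \<in> sets M \<Longrightarrow> C \<subseteq> B \<Longrightarrow> measure M C = 0 \<or> measure M (B - C) = 0"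
    and outside: "\<And>C. C \<in> sets M \<Longrightarrow> C \<inter> \<Union>\<F> = {} \<Longrightarrow> emeasure M C < \<infinity> \<Longrightarrow> measure M C = 0"
  obtain a where a: "bij_betw a {0..<card \<F>} \<F>"
    using ex_bij_betw_nat_finite[OF fin] by blast
  define d where "d = card \<F>"
  have a_in: "a i \<in> \<F>" if "i < d" for i
    using a that by (auto simp: bij_betw_def d_def)
  have a_pos: "a i \<in> sets M" "emeasure M (a i) < \<infinity>" "measure M (a i) > 0" if "i < d" for i
    using a_in[OF that] pos by (auto simp: pos_sets_def)
  have a_disj: "i = j" if "i < d" "j < d" "x \<in> a i" "x \<in> a j" for i j x
  proof (rule ccontr)
    assume "i \<noteq> j"
    then have "a i \<noteq> a j" using a that(1,2) by (auto simp: bij_betw_def d_def inj_on_def)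
    then have "a i \<inter> a j = {}" using a_in[OF that(1)] a_in[OF that(2)] disj by (auto simp: disjoint_def)
    then show False using that by blast
  qed
  have a_Un: "(\<Union>i<d. a i) = \<Union>\<F>"
    using a by (auto simp: bij_betw_def d_def lessThan_atLeast0)
  have eval: "(\<Sum>n<d. c n * indicat_real (a n) x) = c i"
    if "i < d" "x \<in> a i" for c :: "nat \<Rightarrow> real" and i x
  proof -
    have "c n * indicat_real (a n) x = (if n = i then c i else 0)" if "n \<in> {..<d}" for n
    proof -
      have "x \<in> a n \<longleftrightarrow> n = i"
        using a_disj[of n i x] that \<open>i < d\<close> \<open>x \<in> a i\<close> by blast
      then show ?thesis by (simp add: indicator_def)
    qed
    then have "(\<Sum>n<d. c n * indicat_real (a n) x) = (\<Sum>n<d. if n = i then c i else 0)"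
      by (rule sum.cong[OF refl])
    then show ?thesis using that(1) by simp
  qed
  have "L1_finite_basis M d (\<lambda>i. indicat_real (a i))"
    unfolding L1_finite_basis_def
  proof (intro conjI allI impI ballI)
    show "indicat_real (a n) \<in> L1 M" if "n < d" for n
      using a_pos[OF that] by (intro L1_indicator)
    fix f assume f: "f \<in> L1 M"
    define c where "c = (\<lambda>i\<in>{..<d}. (\<integral>x. indicat_real (a i) x * f x \<partial>M) / measure M (a i))"
    have "AE x in M. x \<in> a i \<longrightarrow> f x = c i" if "i \<in> {..<d}" for i
    proof -
      have i: "i < d" using that by simp
      have "c i = (\<integral>x. indicat_real (a i) x * f x \<partial>M) / measure M (a i)"
        using i by (simp add: c_def)
      then show ?thesis
        using AE_eq_mean_on_atom[OF f a_pos(1)[OF i] a_pos(2)[OF i] a_pos(3)[OF i] atom[OF a_in[OF i]]]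
        by (simp only:)
    qed
    then have "AE x in M. \<forall>i\<in>{..<d}. x \<in> a i \<longrightarrow> f x = c i"
      by (intro AE_finite_allI) auto
    moreover have "AE x in M. x \<notin> \<Union>\<F> \<longrightarrow> f x = 0"
    proof (rule AE_eq_0_outside[OF f])
      show "\<Union>\<F> \<in> sets M" using fin pos by (auto simp: pos_sets_def)
    qed (rule outside)
    ultimately have c: "AE x in M. f x = (\<Sum>n<d. c n * indicat_real (a n) x)"
    proof eventually_elim
      case (elim x)
      show ?case
      proof (cases "x \<in> \<Union>\<F>")
        case True
        then obtain i where "i < d" "x \<in> a i" using a_Un by blast
        then show ?thesis using elim(1) eval[of i x c] by simp
      next
        case False
        then have "x \<notin> a n" if "n < d" for n using that a_Un by blast
        then show ?thesis using elim(2) False by simp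
      qed
    qed
    show "\<exists>!c. c \<in> {..<d} \<rightarrow>\<^sub>E (UNIV :: real set) \<and>
        (AE x in M. f x = (\<Sum>n<d. c n * indicat_real (a n) x))"
    proof (rule ex1I[of _ c])
      show "c \<in> {..<d} \<rightarrow>\<^sub>E UNIV \<and> (AE x in M. f x = (\<Sum>n<d. c n * indicat_real (a n) x))"
        using c by (auto simp: c_def)
      fix c' assume c': "c' \<in> {..<d} \<rightarrow>\<^sub>E UNIV \<and> (AE x in M. f x = (\<Sum>n<d. c' n * indicat_real (a n) x))"
      have "c' i = c i" if i: "i < d" for i
      proof (rule ccontr)
        assume "c' i \<noteq> c i"
        from c c'[THEN conjunct2] have "AE x in M. x \<notin> a i"
        proof eventually_elim
          case (elim x)
          then show ?case using eval[OF i, of x c] eval[OF i, of x c'] \<open>c' i \<noteq> c i\<close> by auto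
        qed
        then have "a i \<in> null_sets M"
          using AE_iff_null_sets[OF a_pos(1)[OF i]] by blast
        then show False using a_pos(3)[OF i] by (simp add: measure_eq_0_null_sets)
      qed
      then show "c' = c"
        using c' by (intro PiE_ext[of c' "{..<d}" "\<lambda>_. UNIV" c]) (auto simp: c_def)
    qed
  qed
  moreover have "\<forall>n<d. nonneg_ae M (indicat_real (a n))" by (simp add: nonneg_ae_def)
  ultimately show ?thesis by blast
qed

theorem theorem1:
  shows "(\<exists>b. L1_schauder_basis (lebesgue_on {0<..} :: real measure) b \<and>
            (\<forall>n. nonneg_ae (lebesgue_on {0<..}) (b n))) \<and>
         (\<forall>M :: 'a measure. L1_separable M \<longrightarrow>
            (\<exists>b. L1_schauder_basis M b \<and> (\<forall>n. nonneg_ae M (b n))) \<or>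
            (\<exists>d b. L1_finite_basis M d b \<and> (\<forall>n<d. nonneg_ae M (b n))))"
proof (intro conjI allI impI)
  show "\<exists>b. L1_schauder_basis (lebesgue_on {0<..} :: real measure) b \<and>
      (\<forall>n. nonneg_ae (lebesgue_on {0<..}) (b n))"
    by (rule half_line_nonneg_schauder_basis)
  fix M :: "'a measure" assume sep: "L1_separable M"
  show "(\<exists>b. L1_schauder_basis M b \<and> (\<forall>n. nonneg_ae M (b n))) \<or>
      (\<exists>d b. L1_finite_basis M d b \<and> (\<forall>n<d. nonneg_ae M (b n)))"
  proof (cases "finitely_split M (space M)")
    case True
    then show ?thesis by (intro disjI2 finite_nonneg_basis)
  next
    case False
    obtain F :: "nat \<Rightarrow> 'a set" where F: "disjoint_family F" "\<And>i. F i \<in> pos_sets M (space M)"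
      using infinite_disjoint_positive_sequence[OF False] by blast
    obtain A :: "nat \<Rightarrow> 'a set" where A: "\<And>n. A n \<in> sets M" "\<And>n. emeasure M (A n) < \<infinity>"
      and total: "L1_total M (range (\<lambda>n. indicat_real (A n)))"
      using L1_separable_total_sequence[OF sep] by blast
    have Fs: "F i \<in> sets M" "emeasure M (F i) < \<infinity>" "measure M (F i) > 0" for i
      using F(2)[of i] by (auto simp: pos_sets_def)
    show ?thesis
      by (rule disjI1) (rule nonneg_schauder_basis_if_total[OF A total Fs F(1)])
  qed
qed

end
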